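(* If $n\geq1$ then $|q_n(q_nz-p_n)|$ is greater than each of $$\text{i) }\frac{(1-\varepsilon^2)^2}{4\varepsilon^2\mu^2|z_n|},\qquad\text{ii) }\frac{(1-\varepsilon^2)^2|b_{n+1}|}{10\varepsilon^3\mu^3|a_{n+1}|},\qquad\text{iii) }\frac{(1-\varepsilon^2)^2|q_n|}{4\varepsilon^2\mu^2|q_{n+1}|}.$$
   Context: Let $\mathcal{O}=\mathbb{Z}[\tau]$ be the ring of discriminant $\Delta$ in an imaginary quadratic field $K$. An ideal is reduced if it is integral and has minimal norm among integral ideals in its class; $D(z,r)$ is the closed disc of radius $r$ centered at $z$. A nonempty finite $B\subset\mathcal{O}\setminus\{0\}$ is admissible with $\varepsilon\in(0,1)$ if for every reduced ideal $\mathfrak{b}$ with $\mathfrak{b}\cap B\neq\emptyset$, $\mathbb{C}=\bigcup D(a/b,\varepsilon/|b|)$ over $a\in\mathfrak{b}^{-1}$, $b\in\mathfrak{b}\cap B$ with $(a\mathfrak{b},b/\mathfrak{b})$ reduced. Fix such $B,\varepsilon$ and let $\mu=\max_{b\in B}|b|$. Let $S(a,b)=\begin{bmatrix}a&1\\ b&0\end{bmatrix}$, $(M)_1$ the ideal generated by the first-column entries of $M$; matrices act as Möbius transformations. Given $z\in\mathbb{C}$, the continued fraction algorithm sets $M_0=I$, $b_0=1$, and for $n\ge1$ chooses (in any way) $b_n\in B$ and $a_n\in\mathcal{O}\cap D(b_nM_{n-1}^{-1}(z),\varepsilon|b_{n-1}|)$ with $(M_{n-1}S(a_n/b_{n-1},b_n/b_{n-1}))_1$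 reduced, and sets $M_n=M_{n-1}S(a_n/b_{n-1},b_n/b_{n-1})$, stopping if $z$ equals the first-column ratio of $M_n$. Let $z_n=M_n^{-1}(z)$ and let $p_n,q_n$ be the left-column entries of $M_n$; the $p_n/q_n$ are the convergents. *)

theory Defs
  imports "HOL-Analysis.Analysis" "HOL-Library.Extended_Nat"
begin

definition tau :: "int \<Rightarrow> complex" where
  "tau \<Delta> = (of_int \<Delta> + csqrt (of_int \<Delta>)) / 2"

text \<open>
  For \<open>\<Delta> < 0\<close> with \<open>\<Delta> mod 4 \<in> {0, 1}\<close>, \<open>tau \<Delta>\<close> is a root of
  \<open>X\<^sup>2 - \<Delta> X + (\<Delta>\<^sup>2 - \<Delta>) / 4\<close>, a monic integral polynomial of discriminant \<open>\<Delta>\<close>.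
  So the following set is the ring \<open>\<int>[\<tau>]\<close>, the quadratic order of discriminant \<open>\<Delta>\<close>;
  it is the ring of integers of its field of fractions precisely if \<open>\<Delta>\<close> is fundamental.
\<close>

definition quad_ring :: "int \<Rightarrow> complex set" where
  "quad_ring \<Delta> = {of_int x + of_int y * tau \<Delta> | x y. True}"

definition quad_field :: "int \<Rightarrow> complex set" where
  "quad_field \<Delta> = {of_rat x + of_rat y * tau \<Delta> | x y. True}"

definition is_submodule :: "int \<Rightarrow> complex set \<Rightarrow> bool" where
  "is_submodule \<Delta> I \<longleftrightarrow>
     0 \<in> I \<and> (\<forall>x\<in>I. \<forall>y\<in>I. x + y \<in> I) \<and> (\<forall>r\<in>quad_ring \<Delta>. \<forall>x\<in>I. r * x \<in> I)"

definition frac_ideal :: "int \<Rightarrow> complex set \<Rightarrow> bool" where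
  "frac_ideal \<Delta> I \<longleftrightarrow>
     is_submodule \<Delta> I \<and> I \<subseteq> quad_field \<Delta> \<and> I \<noteq> {0} \<and>
     (\<exists>d\<in>quad_ring \<Delta> - {0}. \<forall>x\<in>I. d * x \<in> quad_ring \<Delta>)"

definition integral_ideal :: "int \<Rightarrow> complex set \<Rightarrow> bool" where
  "integral_ideal \<Delta> I \<longleftrightarrow> frac_ideal \<Delta> I \<and> I \<subseteq> quad_ring \<Delta>"

definition ideal_gen :: "int \<Rightarrow> complex set \<Rightarrow> complex set" where
  "ideal_gen \<Delta> X = is_submodule \<Delta> hull X"

definition ideal_inv :: "int \<Rightarrow> complex set \<Rightarrow> complex set" where
  "ideal_inv \<Delta> I = {x \<in> quad_field \<Delta>. \<forall>y\<in>I. x * y \<in> quad_ring \<Delta>}"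

text \<open>The norm of an integral ideal is the index \<open>[\<O> : I]\<close>.\<close>

definition ideal_norm :: "int \<Rightarrow> complex set \<Rightarrow> nat" where
  "ideal_norm \<Delta> I =
     card (quad_ring \<Delta> // {(x, y). x \<in> quad_ring \<Delta> \<and> y \<in> quad_ring \<Delta> \<and> x - y \<in> I})"

definition same_class :: "int \<Rightarrow> complex set \<Rightarrow> complex set \<Rightarrow> bool" where
  "same_class \<Delta> I J \<longleftrightarrow> (\<exists>c\<in>quad_field \<Delta> - {0}. J = (*) c ` I)"

definition reduced :: "int \<Rightarrow> complex set \<Rightarrow> bool" where
  "reduced \<Delta> I \<longleftrightarrow>
     integral_ideal \<Delta> I \<and>
     (\<forall>J. integral_ideal \<Delta> J \<and> same_class \<Delta> I J \<longrightarrow> ideal_norm \<Delta> I \<le> ideal_norm \<Delta> J)"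

definition admissible :: "int \<Rightarrow> complex set \<Rightarrow> real \<Rightarrow> bool" where
  "admissible \<Delta> B \<epsilon> \<longleftrightarrow>
     finite B \<and> B \<noteq> {} \<and> B \<subseteq> quad_ring \<Delta> - {0} \<and> 0 < \<epsilon> \<and> \<epsilon> < 1 \<and>
     (\<forall>I. reduced \<Delta> I \<and> I \<inter> B \<noteq> {} \<longrightarrow>
        UNIV = \<Union>{cball (a / b) (\<epsilon> / norm b) | a b.
                  a \<in> ideal_inv \<Delta> I \<and> b \<in> I \<inter> B \<and>
                  reduced \<Delta> (ideal_gen \<Delta> ((*) a ` I \<union> (*) b ` ideal_inv \<Delta> I))})"

definition S_mat :: "complex \<Rightarrow> complex \<Rightarrow> complex^2^2" where
  "S_mat a b = vector [vector [a, 1], vector [b, 0]]"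

definition first_col_ideal :: "int \<Rightarrow> complex^2^2 \<Rightarrow> complex set" where
  "first_col_ideal \<Delta> M = ideal_gen \<Delta> {M$1$1, M$2$1}"

text \<open>
  The action on finite points.  In a run of the algorithm below, \<open>matrix_inv (M n)\<close> is only
  applied to \<open>z\<close> before stopping, that is, when \<open>z\<close> is not the first-column ratio of \<open>M n\<close>,
  so the image of \<open>z\<close> is never \<open>\<infinity>\<close>.
\<close>

definition mat_act :: "complex^2^2 \<Rightarrow> complex \<Rightarrow> complex" where
  "mat_act M = moebius (M$1$1) (M$1$2) (M$2$1) (M$2$2)"

text \<open>The condition \<open>M$2$1 \<noteq> 0\<close> is there because a ratio \<open>p / 0\<close> is \<open>\<infinity>\<close>, never a complex \<open>z\<close>.\<close>

definition is_first_col_ratio :: "complex^2^2 \<Rightarrow> complex \<Rightarrow> bool" where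
  "is_first_col_ratio M z \<longleftrightarrow> M$2$1 \<noteq> 0 \<and> z = M$1$1 / M$2$1"

text \<open>
  \<open>cf_run \<Delta> B \<epsilon> z N a b M\<close>: the sequences \<open>a\<close>, \<open>b\<close>, \<open>M\<close> record an execution of the
  algorithm on input \<open>z\<close> with \<open>N \<le> \<infinity>\<close> steps, for some choice of the \<open>a n\<close> and \<open>b n\<close>.
  It stops after step \<open>N\<close>, or not at all if \<open>N = \<infinity>\<close>.  The values \<open>a 0\<close>, and
  \<open>a n\<close>, \<open>b n\<close>, \<open>M n\<close> for \<open>n > N\<close>, carry no meaning.
\<close>

definition cf_run ::
  "int \<Rightarrow> complex set \<Rightarrow> real \<Rightarrow> complex \<Rightarrow> enat \<Rightarrow>
   (nat \<Rightarrow> complex) \<Rightarrow> (nat \<Rightarrow> complex) \<Rightarrow> (nat \<Rightarrow> complex^2^2) \<Rightarrow> bool" where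
  "cf_run \<Delta> B \<epsilon> z N a b M \<longleftrightarrow>
     M 0 = mat 1 \<and> b 0 = 1 \<and>
     (\<forall>n. enat (Suc n) \<le> N \<longrightarrow>
        b (Suc n) \<in> B \<and>
        a (Suc n) \<in> quad_ring \<Delta> \<inter>
          cball (b (Suc n) * mat_act (matrix_inv (M n)) z) (\<epsilon> * norm (b n)) \<and>
        M (Suc n) = M n ** S_mat (a (Suc n) / b n) (b (Suc n) / b n) \<and>
        reduced \<Delta> (first_col_ideal \<Delta> (M (Suc n)))) \<and>
     (\<forall>n. enat n \<le> N \<longrightarrow> (enat n = N \<longleftrightarrow> is_first_col_ratio (M n) z))"

end

theory Submission
  imports Defs
begin

text \<open>
  Put \<open>e\<^sub>n = q\<^sub>n z - p\<^sub>n\<close>. The choice of \<open>a\<^sub>n\<close> gives \<open>|e\<^sub>n| \<le> \<epsilon> |e\<^sub>n\<^sub>-\<^sub>1|\<close>, and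
  \<open>z\<^sub>n = - e\<^sub>n\<^sub>-\<^sub>1 / e\<^sub>n\<close>, so (i) and (iii) are lower bounds for \<open>|q\<^sub>m e\<^sub>m\<^sub>-\<^sub>1|\<close> with \<open>m = n\<close> and
  \<open>m = n + 1\<close>, while (ii) follows from a slightly different constant in the same bound.
  The determinant of \<open>M\<^sub>k\<close> has absolute value \<open>|b\<^sub>k| \<le> \<mu>\<close>, whence
  \<open>|q\<^sub>k e\<^sub>k\<^sub>-\<^sub>1| \<le> \<mu> / (1 - \<epsilon>\<^sup>2)\<close>. For \<open>k < m\<close> the number \<open>q\<^sub>m e\<^sub>k - q\<^sub>k e\<^sub>m\<close> lies in the order and
  is nonzero because the ideals of the columns are reduced, so it has absolute value at least \<open>1\<close>.
  For a suitable \<open>k\<close> the term \<open>q\<^sub>k e\<^sub>m\<close> is small, which bounds \<open>|q\<^sub>m|\<close> from below. Finally, the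
  covering property of \<open>B\<close> forces \<open>\<epsilon> \<mu> \<ge> 4 / 7\<close>, which suffices for the constants.
\<close>

section \<open>Orders in imaginary quadratic fields\<close>

locale quad_order =
  fixes \<Delta> :: int
  assumes neg: "\<Delta> < 0" and disc: "\<Delta> mod 4 \<in> {0, 1}"
begin

lemma disc_le: "\<Delta> \<le> -3"
  using neg disc by auto presburger+

lemma Re_tau: "Re (tau \<Delta>) = \<Delta> / 2"
  and Im_tau: "Im (tau \<Delta>) = sqrt (- \<Delta>) / 2"
proof -
  have "csqrt (of_int \<Delta>) = \<i> * sqrt (- \<Delta>)"
    using neg csqrt_of_real_nonpos[of "of_int \<Delta>"] by simp
  then show "Re (tau \<Delta>) = \<Delta> / 2" "Im (tau \<Delta>) = sqrt (- \<Delta>) / 2"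
    by (simp_all add: tau_def)
qed

lemma Im_tau_ge: "Im (tau \<Delta>) \<ge> sqrt 3 / 2"
  using disc_le by (simp add: Im_tau)

lemma cnj_tau: "cnj (tau \<Delta>) = of_int \<Delta> - tau \<Delta>"
  by (simp add: complex_eq_iff Re_tau)

text \<open>The norm of \<open>tau \<Delta>\<close> is (\<Delta>^2 - \<Delta>) / 4, an integer
  because the congruence makes 4 divide \<Delta>(\<Delta> - 1).\<close>

lemma tau_times_cnj_obtains:
  obtains k :: int where "tau \<Delta> * cnj (tau \<Delta>) = of_int k"
proof -
  have "4 dvd \<Delta> \<or> 4 dvd \<Delta> - 1" using disc by auto presburger+
  then have "4 dvd \<Delta> * (\<Delta> - 1)" by auto
  then obtain k where k: "\<Delta> * (\<Delta> - 1) = 4 * k" by blast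
  have "real_of_int (\<Delta> * (\<Delta> - 1)) = 4 * k" using k by simp
  then have "(\<Delta> / 2)\<^sup>2 + (sqrt (- \<Delta>) / 2)\<^sup>2 = real_of_int k"
    using neg by (simp add: power_divide algebra_simps power2_eq_square)
  then have "tau \<Delta> * cnj (tau \<Delta>) = of_int k"
    by (simp add: complex_eq_iff Re_tau Im_tau power2_eq_square)
  then show ?thesis using that by blast
qed

lemma quad_ringI: "of_int x + of_int y * tau \<Delta> \<in> quad_ring \<Delta>"
  unfolding quad_ring_def by blast

lemma of_int_in_quad_ring: "of_int x \<in> quad_ring \<Delta>"
  using quad_ringI[of x 0] by simp

lemma zero_in_quad_ring: "0 \<in> quad_ring \<Delta>" and one_in_quad_ring: "1 \<in> quad_ring \<Delta>"
  using of_int_in_quad_ring[of 0] of_int_in_quad_ring[of 1] by simp_all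

lemma quad_ring_add: "u \<in> quad_ring \<Delta> \<Longrightarrow> w \<in> quad_ring \<Delta> \<Longrightarrow> u + w \<in> quad_ring \<Delta>"
proof -
  assume "u \<in> quad_ring \<Delta>" "w \<in> quad_ring \<Delta>"
  then obtain a b c d where "u = of_int a + of_int b * tau \<Delta>" "w = of_int c + of_int d * tau \<Delta>"
    unfolding quad_ring_def by blast
  then show ?thesis using quad_ringI[of "a + c" "b + d"] by (simp add: algebra_simps)
qed

lemma quad_ring_minus: "u \<in> quad_ring \<Delta> \<Longrightarrow> - u \<in> quad_ring \<Delta>"
proof -
  assume "u \<in> quad_ring \<Delta>"
  then obtain a b where "u = of_int a + of_int b * tau \<Delta>"
    unfolding quad_ring_def by blast
  then show ?thesis using quad_ringI[of "- a" "- b"] by simp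
qed

lemma quad_ring_diff: "u \<in> quad_ring \<Delta> \<Longrightarrow> w \<in> quad_ring \<Delta> \<Longrightarrow> u - w \<in> quad_ring \<Delta>"
  using quad_ring_add[of u "- w"] quad_ring_minus by simp

lemma quad_ring_mult: "u \<in> quad_ring \<Delta> \<Longrightarrow> w \<in> quad_ring \<Delta> \<Longrightarrow> u * w \<in> quad_ring \<Delta>"
proof -
  assume "u \<in> quad_ring \<Delta>" "w \<in> quad_ring \<Delta>"
  then obtain a b c d where uw: "u = of_int a + of_int b * tau \<Delta>" "w = of_int c + of_int d * tau \<Delta>"
    unfolding quad_ring_def by blast
  obtain k :: int where k: "tau \<Delta> * (of_int \<Delta> - tau \<Delta>) = of_int k"
    using tau_times_cnj_obtains cnj_tau by metis
  have sq: "tau \<Delta> * tau \<Delta> = of_int \<Delta> * tau \<Delta> - of_int k"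
    using k by (simp add: algebra_simps)
  have "u * w = of_int (a * c) + of_int (a * d + b * c) * tau \<Delta> + of_int (b * d) * (tau \<Delta> * tau \<Delta>)"
    unfolding uw by (simp add: algebra_simps)
  also have "\<dots> = of_int (a * c - b * d * k) + of_int (a * d + b * c + b * d * \<Delta>) * tau \<Delta>"
    unfolding sq by (simp add: algebra_simps)
  finally show ?thesis by (simp only: quad_ringI)
qed

section \<open>Conjugation, integral norms and division in the order\<close>

lemma quad_ring_cnj: "u \<in> quad_ring \<Delta> \<Longrightarrow> cnj u \<in> quad_ring \<Delta>"
proof -
  assume "u \<in> quad_ring \<Delta>"
  then obtain a b where "u = of_int a + of_int b * tau \<Delta>"
    unfolding quad_ring_def by blast
  then show ?thesis
    using quad_ringI[of "a + b * \<Delta>" "- b"] by (simp add: cnj_tau algebra_simps)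
qed

lemma quad_ring_norm_obtains:
  assumes "u \<in> quad_ring \<Delta>"
  obtains k :: int where "u * cnj u = of_int k" "(norm u)\<^sup>2 = of_int k"
proof -
  obtain a b where u: "u = of_int a + of_int b * tau \<Delta>"
    using assms unfolding quad_ring_def by blast
  obtain k :: int where k: "tau \<Delta> * (of_int \<Delta> - tau \<Delta>) = of_int k"
    using tau_times_cnj_obtains cnj_tau by metis
  have "u * cnj u = of_int (a * a + a * b * \<Delta>) + of_int (b * b) * (tau \<Delta> * (of_int \<Delta> - tau \<Delta>))"
    unfolding u by (simp add: cnj_tau algebra_simps)
  then have *: "u * cnj u = of_int (a * a + a * b * \<Delta> + b * b * k)"
    unfolding k by simp
  then have "complex_of_real ((norm u)\<^sup>2) = of_real (of_int (a * a + a * b * \<Delta> + b * b * k))"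
    using complex_norm_square[of u] by simp
  then have "(norm u)\<^sup>2 = of_int (a * a + a * b * \<Delta> + b * b * k)"
    by (simp only: of_real_eq_iff)
  then show ?thesis using * that by blast
qed

lemma quad_ring_norm_ge_1:
  assumes "u \<in> quad_ring \<Delta>" "u \<noteq> 0"
  shows "norm u \<ge> 1"
proof -
  obtain k :: int where k: "(norm u)\<^sup>2 = of_int k"
    using quad_ring_norm_obtains[OF assms(1)] by metis
  have "(norm u)\<^sup>2 > 0" using assms(2) by simp
  then have "k \<ge> 1" using k by simp
  then have "(norm u)\<^sup>2 \<ge> 1\<^sup>2" using k by simp
  then show ?thesis using power2_le_imp_le norm_ge_zero by blast
qed

lemma quad_ring_norm_gt_1:
  assumes "u \<in> quad_ring \<Delta>" "norm u > 1"
  shows "norm u \<ge> sqrt 2"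
proof -
  obtain k :: int where k: "(norm u)\<^sup>2 = of_int k"
    using quad_ring_norm_obtains[OF assms(1)] by metis
  have "(norm u)\<^sup>2 > 1" using assms(2) by (simp add: one_less_power)
  then have "k \<ge> 2" using k by simp
  then show ?thesis using k by (simp add: real_le_lsqrt)
qed

text \<open>The denominator cleared is a natural number m because the index of mO can be counted
  directly.\<close>

lemma quad_field_obtains:
  assumes "c \<in> quad_field \<Delta>"
  obtains m :: nat and x where "m > 0" "x \<in> quad_ring \<Delta>" "of_nat m * c = x"
proof -
  obtain r s where c: "c = of_rat r + of_rat s * tau \<Delta>"
    using assms unfolding quad_field_def by blast
  obtain r1 r2 where r: "r = of_int r1 / of_int r2" "r2 > 0"
    by (metis quotient_of_div quotient_of_denom_pos surj_pair)
  obtain s1 s2 where s: "s = of_int s1 / of_int s2" "s2 > 0"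
    by (metis quotient_of_div quotient_of_denom_pos surj_pair)
  have "of_nat (nat (r2 * s2)) * c = of_int (r1 * s2) + of_int (s1 * r2) * tau \<Delta>"
    using r(2) s(2) unfolding c r(1) s(1) by (simp add: of_rat_divide field_simps)
  moreover have "nat (r2 * s2) > 0" using r(2) s(2) by simp
  ultimately show ?thesis using that quad_ringI by metis
qed

lemma quad_field_divide:
  assumes "u \<in> quad_ring \<Delta>" "w \<in> quad_ring \<Delta>"
  shows "u / w \<in> quad_field \<Delta>"
proof -
  obtain k :: int where k: "w * cnj w = of_int k"
    using quad_ring_norm_obtains[OF assms(2)] by metis
  obtain x y where xy: "u * cnj w = of_int x + of_int y * tau \<Delta>"
    using quad_ring_mult[OF assms(1) quad_ring_cnj[OF assms(2)]] unfolding quad_ring_def by blast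
  have "u / w = (u * cnj w) / (w * cnj w)" by simp
  also have "\<dots> = of_rat (of_int x / of_int k) + of_rat (of_int y / of_int k) * tau \<Delta>"
    unfolding k xy by (simp add: of_rat_divide add_divide_distrib)
  finally show ?thesis unfolding quad_field_def by blast
qed

section \<open>Norms of ideals\<close>

lemma is_submodule_quad_ring: "is_submodule \<Delta> (quad_ring \<Delta>)"
  unfolding is_submodule_def using zero_in_quad_ring quad_ring_add quad_ring_mult by blast

lemma is_submodule_minus: "is_submodule \<Delta> I \<Longrightarrow> u \<in> I \<Longrightarrow> - u \<in> I"
  unfolding is_submodule_def using quad_ring_minus[OF one_in_quad_ring]
  by (metis mult_minus1)

lemma is_submodule_diff: "is_submodule \<Delta> I \<Longrightarrow> u \<in> I \<Longrightarrow> w \<in> I \<Longrightarrow> u - w \<in> I"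
  using is_submodule_minus[of I w] unfolding is_submodule_def by (metis diff_conv_add_uminus)

lemma is_submodule_scale:
  assumes "is_submodule \<Delta> I"
  shows "is_submodule \<Delta> ((*) c ` I)"
proof -
  have "c * u + c * w \<in> (*) c ` I" if "u \<in> I" "w \<in> I" for u w
    using that assms unfolding is_submodule_def by (metis distrib_left imageI)
  moreover have "r * (c * u) \<in> (*) c ` I" if "r \<in> quad_ring \<Delta>" "u \<in> I" for r u
    using that assms unfolding is_submodule_def by (metis mult.left_commute imageI)
  ultimately show ?thesis
    using assms unfolding is_submodule_def by (auto simp: image_iff)
qed

text \<open>Systems of representatives modulo \<open>I\<close>. Counting them replaces the quotient
  in \<open>ideal_norm\<close>, so index formulas become statements about sets of ring
  elements.\<close>

definition transversal :: "complex set \<Rightarrow> complex set \<Rightarrow> bool" where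
  "transversal I T \<longleftrightarrow> T \<subseteq> quad_ring \<Delta> \<and> (\<forall>x\<in>quad_ring \<Delta>. \<exists>!t. t \<in> T \<and> x - t \<in> I)"

lemma transversal_exists:
  assumes I: "is_submodule \<Delta> I"
  obtains T where "transversal I T"
proof -
  define f where "f x = (SOME y. y \<in> quad_ring \<Delta> \<and> x - y \<in> I)" for x
  have f: "f x \<in> quad_ring \<Delta> \<and> x - f x \<in> I" if "x \<in> quad_ring \<Delta>" for x
    unfolding f_def by (rule someI[of _ x]) (use that I in \<open>simp add: is_submodule_def\<close>)
  \<comment> \<open>The condition defining \<open>f x\<close> depends only on the coset of
    \<open>x\<close>, so a single choice is made per coset.\<close>
  have cong: "f x = f y" if "x - y \<in> I" for x y
  proof -
    have "(x - w \<in> I) = (y - w \<in> I)" for w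
    proof
      assume "x - w \<in> I"
      then have "(x - w) - (x - y) \<in> I" using is_submodule_diff[OF I] that by blast
      then show "y - w \<in> I" by simp
    next
      assume "y - w \<in> I"
      then have "(x - y) + (y - w) \<in> I" using I that unfolding is_submodule_def by blast
      then show "x - w \<in> I" by simp
    qed
    then show ?thesis unfolding f_def by simp
  qed
  have "\<exists>!t. t \<in> f ` quad_ring \<Delta> \<and> x - t \<in> I" if x: "x \<in> quad_ring \<Delta>" for x
  proof (rule ex1I[of _ "f x"])
    fix t assume "t \<in> f ` quad_ring \<Delta> \<and> x - t \<in> I"
    then obtain y where y: "y \<in> quad_ring \<Delta>" "t = f y" "x - f y \<in> I" by blast
    have "(x - f y) - (y - f y) \<in> I"
      using is_submodule_diff[OF I] y f by blast
    then show "t = f x" using cong[of x y] y by simp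
  qed (use x f in blast)
  then have "transversal I (f ` quad_ring \<Delta>)"
    unfolding transversal_def using f by blast
  then show ?thesis using that by blast
qed

lemma ideal_norm_transversal:
  assumes I: "is_submodule \<Delta> I" and T: "transversal I T"
  shows "ideal_norm \<Delta> I = card T"
proof -
  define R where "R = {(x, y). x \<in> quad_ring \<Delta> \<and> y \<in> quad_ring \<Delta> \<and> x - y \<in> I}"
  have equiv: "equiv (quad_ring \<Delta>) R"
  proof (rule equivI)
    show "R \<subseteq> quad_ring \<Delta> \<times> quad_ring \<Delta>" unfolding R_def by auto
    show "refl_on (quad_ring \<Delta>) R"
      using I unfolding R_def refl_on_def is_submodule_def by auto
    show "sym R"
      using is_submodule_minus[OF I] unfolding R_def sym_def by fastforce
    have "x - w \<in> I" if "x - y \<in> I" "y - w \<in> I" for x y w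
      using that I unfolding is_submodule_def by fastforce
    then show "trans R" unfolding R_def trans_def by blast
  qed
  have "inj_on (\<lambda>t. R `` {t}) T"
  proof (rule inj_onI)
    fix s t assume st: "s \<in> T" "t \<in> T" "R `` {s} = R `` {t}"
    then have "(s, t) \<in> R"
      using T equiv unfolding transversal_def by (meson eq_equiv_class subsetD)
    then show "s = t"
      using st T I unfolding transversal_def R_def is_submodule_def
      by (metis (no_types, lifting) case_prodD cancel_comm_monoid_add_class.diff_cancel mem_Collect_eq)
  qed
  moreover have "(\<lambda>t. R `` {t}) ` T = quad_ring \<Delta> // R"
  proof
    show "(\<lambda>t. R `` {t}) ` T \<subseteq> quad_ring \<Delta> // R"
      using T unfolding transversal_def by (auto intro: quotientI)
    show "quad_ring \<Delta> // R \<subseteq> (\<lambda>t. R `` {t}) ` T"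
    proof
      fix X assume "X \<in> quad_ring \<Delta> // R"
      then obtain x where x: "x \<in> quad_ring \<Delta>" "X = R `` {x}" by (rule quotientE)
      then obtain t where t: "t \<in> T" "x - t \<in> I" using T unfolding transversal_def by blast
      then have "(x, t) \<in> R" using x T unfolding R_def transversal_def by auto
      then have "X = R `` {t}" using x equiv_class_eq[OF equiv] by simp
      then show "X \<in> (\<lambda>t. R `` {t}) ` T" using t by blast
    qed
  qed
  ultimately show ?thesis
    unfolding ideal_norm_def R_def[symmetric] by (metis card_image)
qed

text \<open>The tower formula [O : xI] = [O : xO] [xO : xI], where the last index is [O : I] because
  multiplication by x is injective. Representatives are \<open>u + x * t\<close>, with
  \<open>u\<close> modulo xO and \<open>t\<close> modulo \<open>I\<close>.\<close>

lemma ideal_norm_scale: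
  assumes x: "x \<in> quad_ring \<Delta>" "x \<noteq> 0" and I: "is_submodule \<Delta> I" "I \<subseteq> quad_ring \<Delta>"
  shows "ideal_norm \<Delta> ((*) x ` I) = ideal_norm \<Delta> ((*) x ` quad_ring \<Delta>) * ideal_norm \<Delta> I"
proof -
  have xO: "is_submodule \<Delta> ((*) x ` quad_ring \<Delta>)" and xI: "is_submodule \<Delta> ((*) x ` I)"
    using is_submodule_scale is_submodule_quad_ring I by blast+
  obtain T where T: "transversal I T" using transversal_exists I by blast
  obtain U where U: "transversal ((*) x ` quad_ring \<Delta>) U" using transversal_exists xO by blast
  define g where "g = (\<lambda>(u, t). u + x * t)"
  have TO: "t \<in> quad_ring \<Delta>" if "t \<in> T" for t using T that unfolding transversal_def by blast
  have UO: "u \<in> quad_ring \<Delta>" if "u \<in> U" for u using U that unfolding transversal_def by blast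
  have uniq: "u = u' \<and> t = t'"
    if A: "u \<in> U" "u' \<in> U" "t \<in> T" "t' \<in> T" "y \<in> quad_ring \<Delta>"
      "y - (u + x * t) \<in> (*) x ` I" "y - (u' + x * t') \<in> (*) x ` I" for u u' t t' y
  proof -
    obtain i j where "i \<in> I" "y - (u + x * t) = x * i" "j \<in> I" "y - (u' + x * t') = x * j"
      using A by blast
    then have ij: "i \<in> I" "y = u + x * t + x * i" "j \<in> I" "y = u' + x * t' + x * j"
      by (metis add.commute diff_eq_eq)+
    have "y - u = x * (t + i)" "y - u' = x * (t' + j)"
      using ij by (auto simp: algebra_simps)
    moreover have "t + i \<in> quad_ring \<Delta>" "t' + j \<in> quad_ring \<Delta>"
      using quad_ring_add TO that ij I by blast+
    ultimately have "u = u'" using U that unfolding transversal_def by blast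
    with ij have "x * (t + i) = x * (t' + j)" by (simp add: algebra_simps)
    then have eq: "t + i = t' + j" using x by simp
    define w where "w = t + i"
    have "w - t = i" unfolding w_def by simp
    moreover have "w - t' = j" unfolding w_def eq by simp
    moreover have "w \<in> quad_ring \<Delta>" unfolding w_def by fact
    ultimately have "w - t \<in> I" "w - t' \<in> I" "w \<in> quad_ring \<Delta>" using ij by simp_all
    then have "t = t'" using T that unfolding transversal_def by blast
    with \<open>u = u'\<close> show ?thesis by blast
  qed
  have "\<exists>!s. s \<in> g ` (U \<times> T) \<and> y - s \<in> (*) x ` I" if y: "y \<in> quad_ring \<Delta>" for y
  proof -
    obtain u w where u: "u \<in> U" "w \<in> quad_ring \<Delta>" "y - u = x * w"
      using U y unfolding transversal_def by blast
    obtain t where t: "t \<in> T" "w - t \<in> I" using T u unfolding transversal_def by blast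
    have "y - (u + x * t) = x * (w - t)" using u by (simp add: algebra_simps)
    then have "y - g (u, t) \<in> (*) x ` I" using t unfolding g_def by auto
    moreover have "g (u, t) \<in> g ` (U \<times> T)" using u t by blast
    moreover have "s = s'" if A: "s \<in> g ` (U \<times> T) \<and> y - s \<in> (*) x ` I"
      "s' \<in> g ` (U \<times> T) \<and> y - s' \<in> (*) x ` I" for s s'
    proof -
      obtain u t u' t' where "u \<in> U" "t \<in> T" "s = u + x * t" "u' \<in> U" "t' \<in> T" "s' = u' + x * t'"
        using A unfolding g_def by auto
      with A uniq[of u u' t t' y] y show ?thesis by simp
    qed
    ultimately show ?thesis by blast
  qed
  moreover have "g ` (U \<times> T) \<subseteq> quad_ring \<Delta>"
    using UO TO x quad_ring_add quad_ring_mult unfolding g_def by auto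
  ultimately have "transversal ((*) x ` I) (g ` (U \<times> T))"
    unfolding transversal_def by blast
  moreover have "inj_on g (U \<times> T)"
  proof (rule inj_onI)
    fix r s assume rs: "r \<in> U \<times> T" "s \<in> U \<times> T" "g r = g s"
    have 0: "0 \<in> (*) x ` I" using xI unfolding is_submodule_def by blast
    have "g r \<in> quad_ring \<Delta>" using \<open>g ` (U \<times> T) \<subseteq> quad_ring \<Delta>\<close> rs by blast
    then show "r = s"
      using uniq[of "fst r" "fst s" "snd r" "snd s" "g r"] rs 0
      unfolding g_def by (auto simp: case_prod_beta)
  qed
  ultimately show ?thesis
    using ideal_norm_transversal[OF xI] ideal_norm_transversal[OF xO U]
      ideal_norm_transversal[OF I(1) T] by (simp add: card_image card_cartesian_product)
qed

text \<open>As 1 and \<open>tau \<Delta>\<close> form an integral basis, reducing both coordinates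
  modulo \<open>m\<close> gives representatives. The injectivity is linear independence, needed to
  count them.\<close>

lemma transversal_of_nat:
  assumes "m > 0"
  shows "transversal ((*) (of_nat m) ` quad_ring \<Delta>)
    ((\<lambda>(r, s). of_int r + of_int s * tau \<Delta>) ` ({0..<int m} \<times> {0..<int m}))" (is "transversal ?I ?T")
    and "inj (\<lambda>(r, s). of_int r + of_int s * tau \<Delta>)"
proof -
  have eq: "r = r' \<and> s = s'"
    if "of_int r + of_int s * tau \<Delta> = of_int r' + of_int s' * tau \<Delta>" for r s r' s' :: int
  proof -
    have "Im (tau \<Delta>) > 0" using neg by (simp add: Im_tau)
    with that have "s = s'" by (auto simp: complex_eq_iff)
    with that show ?thesis by simp
  qed
  then show "inj (\<lambda>(r, s). of_int r + of_int s * tau \<Delta>)" by (auto intro!: injI)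
  show "transversal ?I ?T"
    unfolding transversal_def
  proof (intro conjI ballI)
    show "?T \<subseteq> quad_ring \<Delta>" using quad_ringI by auto
    fix y assume "y \<in> quad_ring \<Delta>"
    then obtain c d where y: "y = of_int c + of_int d * tau \<Delta>" unfolding quad_ring_def by blast
    show "\<exists>!t. t \<in> ?T \<and> y - t \<in> ?I"
    proof (rule ex1I)
      let ?t = "of_int (c mod m) + of_int (d mod m) * tau \<Delta>"
      have "of_int c = of_int (c mod m) + of_nat m * (of_int (c div m) :: complex)"
        "of_int d = of_int (d mod m) + of_nat m * (of_int (d div m) :: complex)"
        by (metis mod_mult_div_eq of_int_add of_int_mult of_int_of_nat_eq)+
      then have "y - ?t = of_nat m * (of_int (c div m) + of_int (d div m) * tau \<Delta>)"
        unfolding y by (simp add: algebra_simps)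
      then show "?t \<in> ?T \<and> y - ?t \<in> ?I"
        using assms quad_ringI by (auto intro!: image_eqI[of _ _ "(c mod m, d mod m)"])
      fix t assume t: "t \<in> ?T \<and> y - t \<in> ?I"
      then obtain r s where rs: "t = of_int r + of_int s * tau \<Delta>" "0 \<le> r" "r < m" "0 \<le> s" "s < m"
        by auto
      from t obtain c' d' where "y - t = of_nat m * (of_int c' + of_int d' * tau \<Delta>)"
        unfolding quad_ring_def by blast
      then have "of_int c + of_int d * tau \<Delta> = of_int (r + m * c') + of_int (s + m * d') * tau \<Delta>"
        unfolding y rs by (simp add: algebra_simps)
      then have "c = r + m * c'" "d = s + m * d'" using eq by blast+
      then show "t = ?t" using rs by simp
    qed
  qed
qed

lemma ideal_norm_of_nat:
  assumes "m > 0"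
  shows "ideal_norm \<Delta> ((*) (of_nat m) ` quad_ring \<Delta>) = m\<^sup>2"
  using ideal_norm_transversal[OF is_submodule_scale[OF is_submodule_quad_ring]
      transversal_of_nat(1)[OF assms]] transversal_of_nat(2)[OF assms]
  by (simp add: card_image inj_on_subset card_cartesian_product power2_eq_square)

text \<open>Conjugation is an automorphism of the order, so it carries representatives modulo xO to
  representatives modulo the conjugate ideal.\<close>

lemma ideal_norm_cnj:
  assumes "x \<in> quad_ring \<Delta>"
  shows "ideal_norm \<Delta> ((*) (cnj x) ` quad_ring \<Delta>) = ideal_norm \<Delta> ((*) x ` quad_ring \<Delta>)"
proof -
  have sub: "is_submodule \<Delta> ((*) y ` quad_ring \<Delta>)" for y
    using is_submodule_scale is_submodule_quad_ring by blast
  obtain T where T: "transversal ((*) x ` quad_ring \<Delta>) T" using transversal_exists sub by blast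
  have mem: "y - cnj t \<in> (*) (cnj x) ` quad_ring \<Delta> \<longleftrightarrow> cnj y - t \<in> (*) x ` quad_ring \<Delta>" for y t
  proof
    assume "y - cnj t \<in> (*) (cnj x) ` quad_ring \<Delta>"
    then obtain w where "w \<in> quad_ring \<Delta>" "y - cnj t = cnj x * w" by blast
    then have "cnj y - t = x * cnj w" by (metis complex_cnj_cnj complex_cnj_diff complex_cnj_mult)
    then show "cnj y - t \<in> (*) x ` quad_ring \<Delta>" using \<open>w \<in> _\<close> quad_ring_cnj by blast
  next
    assume "cnj y - t \<in> (*) x ` quad_ring \<Delta>"
    then obtain w where "w \<in> quad_ring \<Delta>" "cnj y - t = x * w" by blast
    then have "y - cnj t = cnj x * cnj w" by (metis complex_cnj_cnj complex_cnj_diff complex_cnj_mult)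
    then show "y - cnj t \<in> (*) (cnj x) ` quad_ring \<Delta>" using \<open>w \<in> _\<close> quad_ring_cnj by blast
  qed
  have "transversal ((*) (cnj x) ` quad_ring \<Delta>) (cnj ` T)"
    unfolding transversal_def
  proof (intro conjI ballI)
    show "cnj ` T \<subseteq> quad_ring \<Delta>" using T quad_ring_cnj unfolding transversal_def by blast
    fix y assume "y \<in> quad_ring \<Delta>"
    then have "\<exists>!t. t \<in> T \<and> cnj y - t \<in> (*) x ` quad_ring \<Delta>"
      using T quad_ring_cnj unfolding transversal_def by blast
    then obtain t where t: "t \<in> T" "cnj y - t \<in> (*) x ` quad_ring \<Delta>"
      and uniq: "\<And>s. s \<in> T \<Longrightarrow> cnj y - s \<in> (*) x ` quad_ring \<Delta> \<Longrightarrow> s = t" by blast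
    show "\<exists>!t. t \<in> cnj ` T \<and> y - t \<in> (*) (cnj x) ` quad_ring \<Delta>"
    proof (rule ex1I[of _ "cnj t"])
      show "cnj t \<in> cnj ` T \<and> y - cnj t \<in> (*) (cnj x) ` quad_ring \<Delta>"
        using t mem by blast
      fix s assume "s \<in> cnj ` T \<and> y - s \<in> (*) (cnj x) ` quad_ring \<Delta>"
      then obtain s' where "s' \<in> T" "s = cnj s'" "y - cnj s' \<in> (*) (cnj x) ` quad_ring \<Delta>" by blast
      then show "s = cnj t" using mem uniq by blast
    qed
  qed
  then show ?thesis
    using ideal_norm_transversal[OF sub] T
    by (metis card_image complex_cnj_cancel_iff inj_onI)
qed

text \<open>With k = \<open>x * cnj x\<close>, the indices for \<open>x\<close> and
  \<open>cnj x\<close> are equal and multiply to the index k^2 of kO, so each is k.\<close>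

lemma ideal_norm_principal:
  assumes x: "x \<in> quad_ring \<Delta>" "x \<noteq> 0"
  shows "real (ideal_norm \<Delta> ((*) x ` quad_ring \<Delta>)) = (norm x)\<^sup>2"
proof -
  obtain k :: int where k: "x * cnj x = of_int k" "(norm x)\<^sup>2 = of_int k"
    using quad_ring_norm_obtains[OF x(1)] by metis
  have "(norm x)\<^sup>2 > 0" using x by simp
  then have pos: "k > 0" using k by simp
  have "(ideal_norm \<Delta> ((*) x ` quad_ring \<Delta>))\<^sup>2 = ideal_norm \<Delta> ((*) x ` (*) (cnj x) ` quad_ring \<Delta>)"
    using ideal_norm_scale[OF x is_submodule_scale[OF is_submodule_quad_ring], of "cnj x"]
      ideal_norm_cnj[OF x(1)] quad_ring_mult[OF quad_ring_cnj[OF x(1)]]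
    by (simp add: power2_eq_square image_subset_iff)
  also have "(*) x ` (*) (cnj x) ` quad_ring \<Delta> = (*) (of_nat (nat k)) ` quad_ring \<Delta>"
    using k(1) pos by (simp add: image_image mult.assoc[symmetric])
  also have "ideal_norm \<Delta> \<dots> = (nat k)\<^sup>2" using ideal_norm_of_nat[of "nat k"] pos by (simp only: zero_less_nat_eq)
  finally have "ideal_norm \<Delta> ((*) x ` quad_ring \<Delta>) = nat k" by simp
  then show ?thesis using k(2) pos by simp
qed

text \<open>The content is finiteness, as an infinite quotient would have \<open>card\<close> 0. A
  nonzero w in \<open>I\<close> puts k = |w|^2 into \<open>I\<close>, so the finitely many
  representatives modulo kO meet every coset of \<open>I\<close>.\<close>

lemma ideal_norm_pos:
  assumes "integral_ideal \<Delta> I"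
  shows "ideal_norm \<Delta> I > 0"
proof -
  have I: "is_submodule \<Delta> I" "I \<subseteq> quad_ring \<Delta>" "I \<noteq> {0}"
    using assms unfolding integral_ideal_def frac_ideal_def by auto
  then obtain w where w: "w \<in> I" "w \<noteq> 0" unfolding is_submodule_def by blast
  obtain k :: int where k: "w * cnj w = of_int k" "(norm w)\<^sup>2 = of_int k"
    using quad_ring_norm_obtains w I by (metis subsetD)
  have "(norm w)\<^sup>2 > 0" using w by simp
  then have pos: "nat k > 0" using k by simp
  have "cnj w * w \<in> I" using w I quad_ring_cnj unfolding is_submodule_def by blast
  then have kI: "of_nat (nat k) \<in> I" using k pos by (simp add: mult.commute)
  obtain T where T: "transversal I T" using transversal_exists I by blast
  obtain U where U: "transversal ((*) (of_nat (nat k)) ` quad_ring \<Delta>) U" "finite U"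
    using transversal_of_nat(1)[OF pos] by (metis finite_SigmaI finite_atLeastLessThan_int finite_imageI)
  have "\<exists>u\<in>U. t - u \<in> I" if t: "t \<in> T" for t
  proof -
    obtain u y where "u \<in> U" "y \<in> quad_ring \<Delta>" "t - u = of_nat (nat k) * y"
      using U T t unfolding transversal_def by blast
    then show ?thesis using kI I unfolding is_submodule_def by (metis mult.commute)
  qed
  then obtain f where f: "\<And>t. t \<in> T \<Longrightarrow> f t \<in> U \<and> t - f t \<in> I" by metis
  have "inj_on f T"
  proof (rule inj_onI)
    fix s t assume st: "s \<in> T" "t \<in> T" "f s = f t"
    then have "f s - s \<in> I" "f s - t \<in> I"
      using f is_submodule_minus[OF I(1)] by (metis minus_diff_eq)+
    moreover have "f s \<in> quad_ring \<Delta>" using f[OF st(1)] U unfolding transversal_def by blast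
    ultimately show "s = t" using T st unfolding transversal_def by blast
  qed
  moreover have "finite (f ` T)" using U(2) f by (meson finite_subset image_subsetI)
  ultimately have "finite T" by (rule finite_imageD[rotated])
  moreover have "T \<noteq> {}" using T zero_in_quad_ring unfolding transversal_def by blast
  ultimately show ?thesis using ideal_norm_transversal[OF I(1) T] by (simp add: card_gt_0_iff)
qed

text \<open>Scaling by \<open>c\<close> multiplies the index by |c|^2: clearing denominators gives
  mJ = xI with x = mc, and \<open>ideal_norm_scale\<close> evaluates both sides.\<close>

lemma ideal_norm_less:
  assumes I: "integral_ideal \<Delta> I" and J: "integral_ideal \<Delta> J"
    and c: "c \<in> quad_field \<Delta>" "c \<noteq> 0" "norm c < 1" and JI: "J = (*) c ` I"
  shows "ideal_norm \<Delta> J < ideal_norm \<Delta> I"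
proof -
  obtain m x where m: "m > 0" "x \<in> quad_ring \<Delta>" "of_nat m * c = x"
    using quad_field_obtains[OF c(1)] by blast
  have x: "x \<noteq> 0" "norm x < m" using m c by (auto simp: norm_mult)
  have "(*) (of_nat m) ` J = (*) x ` I"
    unfolding JI m(3)[symmetric] by (simp add: image_image mult.assoc)
  moreover have "ideal_norm \<Delta> ((*) (of_nat m) ` J) = m\<^sup>2 * ideal_norm \<Delta> J"
    using ideal_norm_scale[of "of_nat m" J] of_int_in_quad_ring[of "int m"] m J ideal_norm_of_nat
    unfolding integral_ideal_def frac_ideal_def by simp
  moreover have "ideal_norm \<Delta> ((*) x ` I) = ideal_norm \<Delta> ((*) x ` quad_ring \<Delta>) * ideal_norm \<Delta> I"
    using ideal_norm_scale[OF m(2) x(1)] I unfolding integral_ideal_def frac_ideal_def by simp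
  ultimately have "real (m\<^sup>2 * ideal_norm \<Delta> J) = (norm x)\<^sup>2 * ideal_norm \<Delta> I"
    using ideal_norm_principal[OF m(2) x(1)] by (metis of_nat_mult)
  also have "\<dots> < (real m)\<^sup>2 * ideal_norm \<Delta> I"
    using x(2) ideal_norm_pos[OF I] by (simp add: power_strict_mono)
  finally show ?thesis using m(1) by simp
qed

section \<open>Reduced ideals and scaling of generators\<close>

lemma reduced_quad_ring: "reduced \<Delta> (quad_ring \<Delta>)"
proof -
  have "x \<in> quad_field \<Delta>" if "x \<in> quad_ring \<Delta>" for x
    using quad_field_divide[OF that one_in_quad_ring] by simp
  moreover have "quad_ring \<Delta> \<noteq> {0}" using one_in_quad_ring by force
  ultimately have "integral_ideal \<Delta> (quad_ring \<Delta>)"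
    unfolding integral_ideal_def frac_ideal_def
    using is_submodule_quad_ring one_in_quad_ring by (auto intro!: bexI[of _ 1])
  moreover have "ideal_norm \<Delta> (quad_ring \<Delta>) = 1"
    using ideal_norm_principal[OF one_in_quad_ring] by simp
  ultimately show ?thesis
    unfolding reduced_def using ideal_norm_pos by (simp add: Suc_leI)
qed

text \<open>Otherwise \<open>J\<close> would have smaller norm than \<open>I\<close> in the same
  class, against the minimality of \<open>I\<close>.\<close>

lemma not_reduced_scale:
  assumes "reduced \<Delta> I" "reduced \<Delta> J" "c \<in> quad_field \<Delta>" "c \<noteq> 0" "norm c < 1"
  shows "J \<noteq> (*) c ` I"
proof
  assume JI: "J = (*) c ` I"
  then have "same_class \<Delta> I J" using assms unfolding same_class_def by blast
  then show False
    using assms ideal_norm_less[OF _ _ assms(3-5) JI] unfolding reduced_def by (meson leD)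
qed

lemma ideal_gen_scale:
  assumes "c \<noteq> 0"
  shows "ideal_gen \<Delta> ((*) c ` X) = (*) c ` ideal_gen \<Delta> X"
proof -
  \<comment> \<open>This inclusion holds for every factor; the reverse one comes from applying it to
    \<open>inverse c\<close> and the scaled set.\<close>
  have sub: "ideal_gen \<Delta> ((*) c ` X) \<subseteq> (*) c ` ideal_gen \<Delta> X" for c X
  proof -
    have "is_submodule \<Delta> (ideal_gen \<Delta> X)"
      unfolding ideal_gen_def by (rule hull_in) (auto simp: is_submodule_def)
    then have "is_submodule \<Delta> ((*) c ` ideal_gen \<Delta> X)" by (rule is_submodule_scale)
    moreover have "(*) c ` X \<subseteq> (*) c ` ideal_gen \<Delta> X"
      unfolding ideal_gen_def by (intro image_mono hull_subset)
    ultimately show ?thesis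
      unfolding ideal_gen_def[of _ "(*) c ` X"] by (intro hull_minimal)
  qed
  have "X = (*) (inverse c) ` (*) c ` X" for X
    using assms by (simp add: image_image mult.assoc[symmetric])
  then have "ideal_gen \<Delta> X \<subseteq> (*) (inverse c) ` ideal_gen \<Delta> ((*) c ` X)"
    using sub[of "inverse c" "(*) c ` X"] by simp
  then have "(*) c ` ideal_gen \<Delta> X \<subseteq> (*) c ` (*) (inverse c) ` ideal_gen \<Delta> ((*) c ` X)" by blast
  also have "\<dots> = ideal_gen \<Delta> ((*) c ` X)"
    using assms by (simp add: image_image mult.assoc[symmetric])
  finally show ?thesis using sub by blast
qed

end

section \<open>Size estimates\<close>

text \<open>For t_j = |q (j+1)| |e j|, the determinant bound and two contraction steps give t_(j+1)
  \<le> \<mu> + \<epsilon>^2 t_j, whose fixed point is the stated bound.\<close>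

lemma denominator_upper_bound:
  fixes e q :: "nat \<Rightarrow> complex" and \<epsilon> \<mu> :: real
  assumes eps: "0 < \<epsilon>" "\<epsilon> < 1" and q0: "q 0 = 0"
    and e: "\<And>j. j < m \<Longrightarrow> norm (e (Suc j)) \<le> \<epsilon> * norm (e j)"
    and det: "\<And>j. j < m \<Longrightarrow> norm (q (Suc j) * e j - q j * e (Suc j)) \<le> \<mu>"
    and "j < m"
  shows "norm (q (Suc j)) * norm (e j) \<le> \<mu> / (1 - \<epsilon>\<^sup>2)"
  using \<open>j < m\<close>
proof (induction j)
  case 0
  have "\<mu> \<ge> 0" using det[OF 0] norm_ge_zero order_trans by blast
  moreover have "0 < 1 - \<epsilon>\<^sup>2" "1 - \<epsilon>\<^sup>2 \<le> 1" using eps by (simp_all add: power_less_one_iff abs_square_less_1)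
  ultimately have "\<mu> \<le> \<mu> / (1 - \<epsilon>\<^sup>2)" by (simp add: le_divide_eq mult_left_le)
  then show ?case using det[OF 0] q0 by (simp add: norm_mult)
next
  case (Suc j)
  have pos: "0 < 1 - \<epsilon>\<^sup>2" using eps by (simp add: power_less_one_iff abs_square_less_1)
  have "norm (e (Suc (Suc j))) \<le> \<epsilon> * (\<epsilon> * norm (e j))"
    using e[of j] e[of "Suc j"] Suc.prems eps by (meson Suc_lessD mult_left_mono order_trans less_imp_le)
  then have "norm (q (Suc j)) * norm (e (Suc (Suc j))) \<le> \<epsilon>\<^sup>2 * (norm (q (Suc j)) * norm (e j))"
    using mult_left_mono[of _ _ "norm (q (Suc j))"] by (fastforce simp: power2_eq_square mult_ac)
  also have "\<dots> \<le> \<epsilon>\<^sup>2 * (\<mu> / (1 - \<epsilon>\<^sup>2))"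
    using Suc by (intro mult_left_mono) auto
  finally have "norm (q (Suc j) * e (Suc (Suc j))) \<le> \<epsilon>\<^sup>2 * (\<mu> / (1 - \<epsilon>\<^sup>2))"
    by (simp add: norm_mult)
  then have "norm (q (Suc (Suc j)) * e (Suc j)) \<le> \<mu> + \<epsilon>\<^sup>2 * (\<mu> / (1 - \<epsilon>\<^sup>2))"
    using det[OF Suc.prems] norm_triangle_sub[of "q (Suc (Suc j)) * e (Suc j)" "q (Suc j) * e (Suc (Suc j))"]
    by linarith
  also have "\<dots> = \<mu> / (1 - \<epsilon>\<^sup>2)" using pos by (simp add: field_simps)
  finally show ?case by (simp add: norm_mult)
qed

text \<open>With v = l / (1 + \<epsilon>), the concave function u (l - \<epsilon> u) equals v^2 at
  both u = v and u = v / \<epsilon>. Between these points w \<le> \<epsilon> u suffices, beyond them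
  w \<le> v.\<close>

lemma concave_gap_bound:
  fixes u w \<epsilon> l :: real
  assumes eps: "0 < \<epsilon>" "\<epsilon> < 1" and lam: "0 < l"
    and u: "l / (1 + \<epsilon>) \<le> u" and w: "w \<le> l / (1 + \<epsilon>)" "w \<le> \<epsilon> * u"
  shows "l / (1 + \<epsilon>)\<^sup>2 \<le> u * (1 - w / l)"
proof -
  define v where "v = l / (1 + \<epsilon>)"
  have lv: "l = v * (1 + \<epsilon>)" "v > 0" using eps lam by (auto simp: v_def)
  have goal: "l / (1 + \<epsilon>)\<^sup>2 = v * v / l"
    using eps lam by (simp add: v_def power2_eq_square)
  have uv: "v \<le> u" "w \<le> v" using u w by (simp_all add: v_def)
  have "v * v \<le> u * (l - w)"
  proof (cases "\<epsilon> * u \<le> v")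
    case True
    have "0 \<le> (u - v) * (v - \<epsilon> * u)" using True uv by simp
    also have "\<dots> = u * (l - \<epsilon> * u) - v * v" by (simp add: lv algebra_simps)
    also have "\<dots> \<le> u * (l - w) - v * v"
      using w uv lv by (intro diff_right_mono mult_left_mono) auto
    finally show ?thesis by simp
  next
    case False
    then have "v * v \<le> v * (\<epsilon> * u)" using lv by (intro mult_left_mono) auto
    also have "\<dots> = u * (l - v)" by (simp add: lv algebra_simps)
    also have "\<dots> \<le> u * (l - w)" using uv lv by (intro mult_left_mono) auto
    finally show ?thesis .
  qed
  then have "v * v / l \<le> u * (l - w) / l" using lam by (intro divide_right_mono) auto
  also have "\<dots> = u * (1 - w / l)" using lam by (simp add: field_simps)
  finally show ?thesis using goal by simp
qed

text \<open>Comparing the \<open>m\<close>-th convergent only with its predecessor fails when the errors decay slowly.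
  One compares it instead with the first convergent whose error is within the factor
  \<open>(1 + \<epsilon>) \<mu> / (1 - \<epsilon>\<^sup>2)\<close> of the \<open>m\<close>-th error.\<close>

lemma denominator_lower_bound:
  fixes e q :: "nat \<Rightarrow> complex" and \<epsilon> \<mu> :: real
  assumes eps: "0 < \<epsilon>" "\<epsilon> < 1" and mu: "0 < \<mu>" and q0: "q 0 = 0"
    and e: "\<And>j. j \<le> m \<Longrightarrow> norm (e (Suc j)) \<le> \<epsilon> * norm (e j)"
    and nz: "\<And>j. j \<le> m \<Longrightarrow> e j \<noteq> 0"
    and det: "\<And>j. j \<le> m \<Longrightarrow> norm (q (Suc j) * e j - q j * e (Suc j)) \<le> \<mu>"
    and int: "\<And>k. k \<le> m \<Longrightarrow> 1 \<le> norm (q (Suc m) * e k - q k * e (Suc m))"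
  shows "norm (q (Suc m)) * norm (e m) \<ge> 1 / (1 + \<epsilon>) \<or>
         norm (q (Suc m)) * norm (e m) \<ge> (1 - \<epsilon>\<^sup>2) / (\<epsilon> * \<mu> * (1 + \<epsilon>)\<^sup>2)"
proof -
  \<comment> \<open>\<open>lam\<close> is the reciprocal of the bound in
    \<open>denominator_upper_bound\<close>. The threshold \<open>v\<close> is the one that balances
    \<open>concave_gap_bound\<close>.\<close>
  define lam where "lam = (1 - \<epsilon>\<^sup>2) / \<mu>"
  define v where "v = lam / (1 + \<epsilon>)"
  \<comment> \<open>The error \<open>e (Suc m)\<close> stands in the numerator because it may be
    0.\<close>
  define u where "u k = norm (e (Suc m)) / norm (e k)" for k
  define Q where "Q = norm (q (Suc m))"
  have pos: "0 < 1 - \<epsilon>\<^sup>2" using eps by (simp add: power_less_one_iff abs_square_less_1)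
  have lam: "lam > 0" using pos mu by (simp add: lam_def)
  have v: "v > 0" using lam eps by (simp add: v_def)
  have x: "norm (e k) > 0" if "k \<le> m" for k using nz[OF that] by simp
  have u_Suc: "u k \<le> \<epsilon> * u (Suc k)" if "Suc k \<le> m" for k
  proof -
    have "norm (e (Suc m)) * norm (e (Suc k)) \<le> norm (e (Suc m)) * (\<epsilon> * norm (e k))"
      using e[of k] that by (intro mult_left_mono) auto
    then show ?thesis unfolding u_def using x[of k] x[of "Suc k"] that by (simp add: field_simps)
  qed
  have u_m: "u m \<le> \<epsilon>" unfolding u_def using e[of m] x[of m] by (simp add: field_simps)
  \<comment> \<open>Of the two terms in \<open>int\<close>, the one with \<open>q (Suc k)\<close> is
    controlled: |e (Suc m)| is |e k| times \<open>u k\<close>, and |q (Suc k)| |e k| is at most 1 /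
    \<open>lam\<close>. Hence the shift between \<open>u k\<close> and
    \<open>e (Suc k)\<close>.\<close>
  have key: "1 - u k / lam \<le> Q * norm (e (Suc k))" if k: "Suc k \<le> m" for k
  proof -
    have "norm (q (Suc k)) * norm (e k) \<le> 1 / lam"
      using denominator_upper_bound[of \<epsilon> q "Suc m" e \<mu> k] eps q0 e det k by (simp add: lam_def)
    then have "norm (q (Suc k)) * norm (e k) * u k \<le> 1 / lam * u k"
      by (intro mult_right_mono) (auto simp: u_def)
    moreover have "norm (e k) * u k = norm (e (Suc m))" using x[of k] k by (simp add: u_def)
    ultimately have "norm (q (Suc k) * e (Suc m)) \<le> u k / lam"
      by (simp add: norm_mult mult.assoc)
    then have "1 - u k / lam \<le> norm (q (Suc m) * e (Suc k))"
      using int[OF k] norm_triangle_ineq4[of "q (Suc m) * e (Suc k)" "q (Suc k) * e (Suc m)"]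
      by linarith
    then show ?thesis by (simp add: norm_mult Q_def)
  qed
  have key0: "1 \<le> Q * norm (e 0)" using int[of 0] q0 by (simp add: norm_mult Q_def)
  show ?thesis
  proof (cases "u m \<le> v")
    \<comment> \<open>Here \<open>key\<close> at the predecessor of \<open>m\<close> suffices, since
      its ratio is at most \<epsilon> v.\<close>
    case True
    have "1 / (1 + \<epsilon>) \<le> Q * norm (e m)"
    proof (cases m)
      case 0
      have "1 / (1 + \<epsilon>) \<le> 1" using eps by simp
      then show ?thesis using 0 key0 by simp
    next
      case (Suc k)
      have "u k \<le> \<epsilon> * v" using u_Suc[of k] Suc True eps by (metis le_refl mult_left_mono order_trans less_imp_le)
      then have "u k / lam \<le> \<epsilon> * v / lam" using lam by (simp add: divide_right_mono)
      also have "\<dots> = \<epsilon> / (1 + \<epsilon>)" using lam by (simp add: v_def)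
      also have "\<dots> = 1 - 1 / (1 + \<epsilon>)" using eps by (simp add: field_simps)
      finally show ?thesis using key[of k] Suc by simp
    qed
    then show ?thesis by (simp add: Q_def)
  next
    case False
    \<comment> \<open>The first index past the threshold; \<open>m\<close> is one. By minimality the
      predecessor has ratio at most \<open>v\<close>, as \<open>concave_gap_bound\<close>
      requires.\<close>
    define k where "k = (LEAST k. v < u k)"
    have vk: "v < u k" unfolding k_def by (rule LeastI[of _ m]) (use False in simp)
    have km: "k \<le> m" unfolding k_def by (rule Least_le) (use False in simp)
    have em: "norm (e (Suc m)) > 0" using vk v by (auto simp: u_def intro: gr0I)
    have bound: "lam / (1 + \<epsilon>)\<^sup>2 \<le> u k * (Q * norm (e k))"
    proof (cases k)
      case 0
      have "lam / (1 + \<epsilon>)\<^sup>2 \<le> v"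
        using lam eps unfolding v_def by (intro divide_left_mono) (auto simp: self_le_power)
      also have "\<dots> \<le> u k * 1" using vk by simp
      also have "\<dots> \<le> u k * (Q * norm (e k))"
        using 0 key0 vk v by (intro mult_left_mono) auto
      finally show ?thesis .
    next
      case (Suc j)
      have "\<not> v < u j" using not_less_Least[of j "\<lambda>k. v < u k"] Suc unfolding k_def by auto
      then have "lam / (1 + \<epsilon>)\<^sup>2 \<le> u k * (1 - u j / lam)"
        using concave_gap_bound[OF eps lam, of "u k" "u j"] vk u_Suc[of j] Suc km
        unfolding v_def by simp
      also have "\<dots> \<le> u k * (Q * norm (e k))"
        using key[of j] Suc km vk v by (intro mult_left_mono) auto
      finally show ?thesis .
    qed
    \<comment> \<open>Both sides are \<open>Q\<close> times |e (Suc m)|, which carries the bound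
      from \<open>k\<close> to \<open>m\<close>.\<close>
    also have "u k * (Q * norm (e k)) = u m * (Q * norm (e m))"
      using x[OF km] x[of m] by (simp add: u_def)
    also have "\<dots> \<le> \<epsilon> * (Q * norm (e m))"
      using u_m by (intro mult_right_mono) (auto simp: Q_def)
    finally have "lam / (1 + \<epsilon>)\<^sup>2 / \<epsilon> \<le> Q * norm (e m)"
      using eps by (simp only: pos_divide_le_eq mult.commute)
    moreover have "lam / (1 + \<epsilon>)\<^sup>2 / \<epsilon> = (1 - \<epsilon>\<^sup>2) / (\<epsilon> * \<mu> * (1 + \<epsilon>)\<^sup>2)"
      by (simp add: lam_def mult_ac)
    ultimately show ?thesis by (simp add: Q_def)
  qed
qed

section \<open>Polynomial inequalities behind the numerical constants\<close>

lemma quartic_bound: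
  fixes x :: real
  assumes "0 < x" "x < 1"
  shows "(1 - x\<^sup>2) * (1 + x)\<^sup>2 \<le> 27 / 16"
proof -
  \<comment> \<open>The maximum 27/16 is attained at x = 1/2, whence the double root.\<close>
  have "27 / 16 - (1 - x\<^sup>2) * (1 + x)\<^sup>2 = (x - 1/2)\<^sup>2 * (x\<^sup>2 + 3 * x + 11 / 4)"
    by (simp add: power2_eq_square algebra_simps)
  also have "\<dots> \<ge> 0" using assms by (intro mult_nonneg_nonneg) auto
  finally show ?thesis by simp
qed

lemma quintic_bound:
  fixes x :: real
  assumes "0 < x" "x < 1"
  shows "(1 - x\<^sup>2)\<^sup>2 * (1 + x) \<le> 10 / 9"
proof -
  have "x\<^sup>2 \<le> 1" "x^3 \<le> 1" using assms by (auto intro: power_le_one)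
  \<comment> \<open>The maximum 3456/3125 is attained at x = 1/5; 10/9 rounds it up.\<close>
  then have "0 \<le> (5 * x - 1)\<^sup>2 * (331 + 185 * x - 175 * x\<^sup>2 - 125 * x^3)"
    using assms by (intro mult_nonneg_nonneg) auto
  also have "\<dots> = 3456 - 3125 * ((1 - x\<^sup>2)\<^sup>2 * (1 + x))"
    by (simp add: power2_eq_square power3_eq_cube algebra_simps)
  finally show ?thesis by simp
qed

text \<open>Here \<open>h\<close> stands for \<epsilon> \<mu>, and the hypothesis on
  \<open>P\<close> is the outcome of \<open>denominator_lower_bound\<close>. The factor 1 + h pays
  for replacing |a| + h by |a| (1 + h) in (ii).\<close>

lemma lower_bound_constants:
  fixes \<epsilon> h P :: real
  assumes eps: "0 < \<epsilon>" "\<epsilon> < 1" and h: "4 / 7 \<le> h"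
    and P: "1 / (1 + \<epsilon>) \<le> P \<or> (1 - \<epsilon>\<^sup>2) / (h * (1 + \<epsilon>)\<^sup>2) \<le> P"
  shows "(1 - \<epsilon>\<^sup>2)\<^sup>2 / (4 * h\<^sup>2) < P" "(1 - \<epsilon>\<^sup>2)\<^sup>2 * (1 + h) / (10 * h^3) < P"
proof -
  have pos: "0 < 1 - \<epsilon>\<^sup>2" "0 < h" using eps h by (simp_all add: power_less_one_iff abs_square_less_1)
  have h2: "h\<^sup>2 \<ge> 16 / 49" using h power_mono[of "4/7" h 2] by (simp add: power2_eq_square)
  have "(1 - \<epsilon>\<^sup>2)\<^sup>2 / (4 * h\<^sup>2) < P \<and> (1 - \<epsilon>\<^sup>2)\<^sup>2 * (1 + h) / (10 * h^3) < P"
    using P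
  proof
    assume P: "1 / (1 + \<epsilon>) \<le> P"
    have "(1 - \<epsilon>\<^sup>2)\<^sup>2 * (1 + \<epsilon>) < 4 * h\<^sup>2"
      using quintic_bound[OF eps] h2 by linarith
    then have "(1 - \<epsilon>\<^sup>2)\<^sup>2 / (4 * h\<^sup>2) < 1 / (1 + \<epsilon>)"
      using pos eps by (simp add: field_simps)
    moreover have "(1 - \<epsilon>\<^sup>2)\<^sup>2 * (1 + \<epsilon>) * (1 + h) < 10 * h^3"
    proof -
      have "(1 - \<epsilon>\<^sup>2)\<^sup>2 * (1 + \<epsilon>) * (1 + h) \<le> 10 / 9 * (1 + h)"
        using quintic_bound[OF eps] pos by (intro mult_right_mono) auto
      \<comment> \<open>The tightest use of 4/7: at h = 4/7 the two sides are about 1.75 and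
        1.87.\<close>
      also have "\<dots> < 10 * h^3"
      proof -
        have "49 * h^3 \<ge> 16 * h" using mult_right_mono[OF h2, of h] pos
          by (simp add: power2_eq_square power3_eq_cube)
        moreover have "49 * (10 / 9 * (1 + h)) < 160 * h" using h by simp
        ultimately show ?thesis using h by simp
      qed
      finally show ?thesis .
    qed
    then have "(1 - \<epsilon>\<^sup>2)\<^sup>2 * (1 + h) / (10 * h^3) < 1 / (1 + \<epsilon>)"
      using pos eps by (simp add: field_simps)
    ultimately show ?thesis using P by linarith
  next
    assume P: "(1 - \<epsilon>\<^sup>2) / (h * (1 + \<epsilon>)\<^sup>2) \<le> P"
    \<comment> \<open>Each target is \<open>R\<close> times a factor, \<open>g / (4 * h)\<close> or
      \<open>g * (1 + h) / (10 * h\<^sup>2)\<close>, which has to be below 1.\<close>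
    define g where "g = (1 - \<epsilon>\<^sup>2) * (1 + \<epsilon>)\<^sup>2"
    define R where "R = (1 - \<epsilon>\<^sup>2) / (h * (1 + \<epsilon>)\<^sup>2)"
    have g: "g \<le> 27 / 16" "0 < g" using quartic_bound[OF eps] pos eps by (simp_all add: g_def)
    have R: "R > 0" using pos eps by (simp add: R_def)
    have "(1 - \<epsilon>\<^sup>2)\<^sup>2 / (4 * h\<^sup>2) = R * (g / (4 * h))"
      using pos eps by (simp add: R_def g_def power2_eq_square)
    also have "\<dots> < R * 1"
      using R pos g h by (intro mult_strict_left_mono) (auto simp: field_simps)
    finally have 1: "(1 - \<epsilon>\<^sup>2)\<^sup>2 / (4 * h\<^sup>2) < R" by simp
    have "g * (1 + h) \<le> 27 / 16 * (1 + h)" using g pos by (intro mult_right_mono) auto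
    also have "\<dots> < 10 * h\<^sup>2"
    proof -
      have "7 * h\<^sup>2 \<ge> 4 * h" using h by (simp add: power2_eq_square)
      moreover have "7 * (27 / 16 * (1 + h)) < 40 * h" using h by simp
      ultimately show ?thesis by simp
    qed
    finally have 2: "g * (1 + h) / (10 * h\<^sup>2) < 1" using pos by (simp add: field_simps)
    have "(1 - \<epsilon>\<^sup>2)\<^sup>2 * (1 + h) / (10 * h^3) = R * (g * (1 + h) / (10 * h\<^sup>2))"
      using pos eps by (simp add: R_def g_def power2_eq_square power3_eq_cube)
    also have "\<dots> < R * 1" using R 2 by (intro mult_strict_left_mono)
    finally show ?thesis using 1 P unfolding R_def by simp
  qed
  then show "(1 - \<epsilon>\<^sup>2)\<^sup>2 / (4 * h\<^sup>2) < P" "(1 - \<epsilon>\<^sup>2)\<^sup>2 * (1 + h) / (10 * h^3) < P" by auto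
qed

section \<open>Admissible sets\<close>

context quad_order
begin

text \<open>The covering property for the order itself, a reduced ideal containing \<open>B\<close>;
  its inverse lies in the order because 1 does.\<close>

lemma admissible_covers:
  assumes "admissible \<Delta> B \<epsilon>"
  obtains a b where "a \<in> quad_ring \<Delta>" "b \<in> B" "norm (a - b * w) \<le> \<epsilon>"
proof -
  have B: "B \<noteq> {}" "B \<subseteq> quad_ring \<Delta> - {0}"
    using assms unfolding admissible_def by auto
  then have "quad_ring \<Delta> \<inter> B \<noteq> {}" by blast
  then have "w \<in> \<Union>{cball (a / b) (\<epsilon> / norm b) | a b. a \<in> ideal_inv \<Delta> (quad_ring \<Delta>) \<and>
      b \<in> quad_ring \<Delta> \<inter> B \<and>
      reduced \<Delta> (ideal_gen \<Delta> ((*) a ` quad_ring \<Delta> \<union> (*) b ` ideal_inv \<Delta> (quad_ring \<Delta>)))}"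
    using assms reduced_quad_ring unfolding admissible_def by blast
  then obtain a b where ab: "a \<in> ideal_inv \<Delta> (quad_ring \<Delta>)" "b \<in> B" "w \<in> cball (a / b) (\<epsilon> / norm b)"
    by blast
  have "a \<in> quad_ring \<Delta>" using ab(1) one_in_quad_ring unfolding ideal_inv_def by fastforce
  moreover have "norm (a - b * w) \<le> \<epsilon>"
  proof -
    have b: "b \<noteq> 0" using ab B by blast
    have "norm (a - b * w) = norm b * norm (a / b - w)"
      unfolding norm_mult[symmetric] using b by (simp add: right_diff_distrib)
    also have "\<dots> \<le> norm b * (\<epsilon> / norm b)"
      using ab(3) by (intro mult_left_mono) (auto simp: dist_norm)
    finally show ?thesis using b by simp
  qed
  ultimately show ?thesis using that ab(2) by blast
qed

text \<open>The point is the circumcenter of 0, 1, (1 + sqrt (-3)) / 2, a deepest hole of the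
  lattice for \<Delta> = -3. Real elements differ from it by at least 1/2 in real part; all others
  lie at least sqrt 3 / 2 off the real line, by \<open>Im_tau_ge\<close>.\<close>

lemma hexagonal_deep_hole:
  assumes "x \<in> quad_ring \<Delta>"
  shows "(norm (x - Complex (1 / 2) (sqrt 3 / 6)))\<^sup>2 \<ge> 1 / 3"
proof -
  obtain r s where x: "x = of_int r + of_int s * tau \<Delta>"
    using assms unfolding quad_ring_def by blast
  have norm_eq: "(norm (x - Complex (1 / 2) (sqrt 3 / 6)))\<^sup>2 = (Re x - 1 / 2)\<^sup>2 + (Im x - sqrt 3 / 6)\<^sup>2"
    by (simp add: cmod_power2)
  show ?thesis
  proof (cases "s = 0")
    case True
    have "(2 * r - 1)\<^sup>2 \<ge> (1::int)"
    proof -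
      have "2 * r - 1 \<noteq> 0" by presburger
      then have "(2 * r - 1)\<^sup>2 > 0" by simp
      then show ?thesis by linarith
    qed
    then have "real_of_int ((2 * r - 1)\<^sup>2) \<ge> 1" by linarith
    then have "(real_of_int r - 1 / 2)\<^sup>2 \<ge> 1 / 4" by (simp add: power2_eq_square algebra_simps)
    then show ?thesis unfolding norm_eq using True by (simp add: x power_divide)
  next
    case False
    have "0 \<le> Im (tau \<Delta>)" using neg by (simp add: Im_tau)
    then have "\<bar>Im x\<bar> = \<bar>real_of_int s\<bar> * Im (tau \<Delta>)" by (simp add: x abs_mult)
    moreover have "1 * (sqrt 3 / 2) \<le> \<bar>real_of_int s\<bar> * Im (tau \<Delta>)"
      using Im_tau_ge False by (intro mult_mono) auto
    moreover have "0 \<le> sqrt 3" by simp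
    ultimately have "\<bar>sqrt 3 / 3\<bar> \<le> \<bar>Im x - sqrt 3 / 6\<bar>" by linarith
    then have "(sqrt 3 / 3)\<^sup>2 \<le> (Im x - sqrt 3 / 6)\<^sup>2" by (simp only: abs_le_square_iff)
    then have "1 / 3 \<le> (Im x - sqrt 3 / 6)\<^sup>2" by (simp add: power_divide)
    then show ?thesis unfolding norm_eq by (simp add: add_increasing)
  qed
qed

text \<open>If all of \<open>B\<close> has norm \<open>1\<close>, a hole of radius at least \<open>1 / sqrt 3\<close> bounds \<open>\<epsilon>\<close>.
  Otherwise \<open>\<mu> \<ge> sqrt 2\<close>, and a point just outside the disc of radius \<open>\<epsilon>\<close> about \<open>0\<close> must lie in a
  disc about some \<open>a / b\<close> with \<open>|a| \<ge> 1\<close>, so that \<open>\<epsilon> \<mu> + \<epsilon> \<ge> 1\<close>.\<close>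

lemma admissible_eps_mu_ge:
  assumes adm: "admissible \<Delta> B \<epsilon>"
  defines "\<mu> \<equiv> Max (norm ` B)"
  shows "\<epsilon> * \<mu> \<ge> 4 / 7"
proof -
  have B: "finite B" "B \<noteq> {}" "B \<subseteq> quad_ring \<Delta> - {0}" and eps: "0 < \<epsilon>" "\<epsilon> < 1"
    using adm unfolding admissible_def by auto
  have le: "norm b \<le> \<mu>" if "b \<in> B" for b using that B unfolding \<mu>_def by simp
  have ge: "norm b \<ge> 1" if "b \<in> B" for b using that B quad_ring_norm_ge_1 by blast
  obtain b0 where b0: "b0 \<in> B" "\<mu> = norm b0"
  proof -
    have "\<mu> \<in> norm ` B" unfolding \<mu>_def using B by (intro Max_in) auto
    then show thesis using that by blast
  qed
  show ?thesis
  proof (cases "\<mu> \<le> 1")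
    case True
    obtain a b where ab: "a \<in> quad_ring \<Delta>" "b \<in> B" "norm (a - b * Complex (1 / 2) (sqrt 3 / 6)) \<le> \<epsilon>"
      using admissible_covers[OF adm] by blast
    have b1: "norm b = 1" using le[OF ab(2)] ge[OF ab(2)] True by simp
    \<comment> \<open>So \<open>b\<close> is a unit with inverse \<open>cnj b\<close> and can be
      divided out within the order.\<close>
    then have "b * cnj b = 1" using complex_norm_square[of b] by simp
    then have "a - b * Complex (1 / 2) (sqrt 3 / 6) = b * (cnj b * a - Complex (1 / 2) (sqrt 3 / 6))"
      by (simp add: right_diff_distrib mult.assoc[symmetric])
    then have "norm (cnj b * a - Complex (1 / 2) (sqrt 3 / 6)) \<le> \<epsilon>"
      using ab(3) b1 by (simp add: norm_mult)
    moreover have "cnj b * a \<in> quad_ring \<Delta>"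
      using quad_ring_mult quad_ring_cnj ab B by blast
    ultimately have "\<epsilon>\<^sup>2 \<ge> 1 / 3"
      using hexagonal_deep_hole by (smt (verit) norm_ge_zero power_mono)
    \<comment> \<open>The constant 4/7 is a rational just below 1 / sqrt 3.\<close>
    then have "\<epsilon>\<^sup>2 \<ge> (4 / 7)\<^sup>2" by (simp add: power2_eq_square)
    then have "\<epsilon> \<ge> 4 / 7" using power2_le_imp_le eps by (meson less_imp_le)
    moreover have "\<mu> = 1" using True ge b0 by force
    ultimately show ?thesis by simp
  next
    case False
    then have mu: "\<mu> \<ge> sqrt 2" using b0 quad_ring_norm_gt_1 B by auto
    show ?thesis
    proof (rule ccontr)
      assume small: "\<not> ?thesis"
      have "sqrt 2 \<ge> 7 / 5" by (rule real_le_rsqrt) (simp add: power2_eq_square)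
      then have mu': "\<mu> \<ge> 7 / 5" using mu by simp
      have "\<epsilon> * (7 / 5) \<le> \<epsilon> * \<mu>" using mu' eps by (intro mult_left_mono) auto
      with small have e: "\<epsilon> < 20 / 49" by simp
      \<comment> \<open>The shift \<open>d\<close> moves the point out of the disc about 0 and costs
        1/50 after multiplication by \<mu>. This fits: \<epsilon> < 20/49 and \<epsilon> \<mu> < 4/7
        leave a gap of 1/49 below 1.\<close>
      define d where "d = 1 / 50 / \<mu>"
      have d: "d > 0" "d * \<mu> = 1 / 50" using mu' by (simp_all add: d_def)
      obtain a b where ab: "a \<in> quad_ring \<Delta>" "b \<in> B" "norm (a - b * of_real (\<epsilon> + d)) \<le> \<epsilon>"
        using admissible_covers[OF adm] by blast
      have bw: "norm (b * of_real (\<epsilon> + d)) = norm b * (\<epsilon> + d)"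
        using eps d by (simp only: norm_mult norm_of_real)
      show False
      proof (cases "a = 0")
        case True
        have "\<epsilon> + d \<le> norm b * (\<epsilon> + d)" using ge[OF ab(2)] eps d by simp
        then show False using ab(3) True bw d by simp
      next
        case False
        have "1 \<le> norm a" using quad_ring_norm_ge_1 ab False by blast
        also have "\<dots> \<le> \<epsilon> + norm b * (\<epsilon> + d)"
          using ab(3) bw norm_triangle_sub[of a "b * of_real (\<epsilon> + d)"] by linarith
        also have "norm b * (\<epsilon> + d) \<le> \<mu> * (\<epsilon> + d)"
          using le[OF ab(2)] eps d by (intro mult_right_mono) auto
        also have "\<mu> * (\<epsilon> + d) = \<epsilon> * \<mu> + 1 / 50" using d by (simp add: algebra_simps)
        finally show False using small e by simp
      qed
    qed
  qed
qed

end

section \<open>The algorithm\<close>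

text \<open>The witness \<open>C\<close> is the adjugate over the determinant. The signs suit
  matrices whose second column is the previous first column, giving
  \<open>- e n / e (Suc n)\<close>.\<close>

lemma mat_act_matrix_inv:
  fixes A :: "complex^2^2"
  assumes "A$1$1 * A$2$2 - A$1$2 * A$2$1 \<noteq> 0"
  shows "mat_act (matrix_inv A) z = - (A$2$2 * z - A$1$2) / (A$2$1 * z - A$1$1)"
proof -
  define d where "d = A$1$1 * A$2$2 - A$1$2 * A$2$1"
  define C :: "complex^2^2" where
    "C = vector [vector [A$2$2 / d, - A$1$2 / d], vector [- A$2$1 / d, A$1$1 / d]]"
  have d: "d \<noteq> 0" using assms by (simp add: d_def)
  have AC: "A ** C = mat 1"
    using d by (simp add: vec_eq_iff forall_2 matrix_matrix_mult_def sum_2 C_def mat_def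
        diff_divide_distrib[symmetric] mult.commute) (simp add: d_def mult.commute)
  moreover have CA: "C ** A = mat 1" using AC matrix_left_right_inverse by blast
  ultimately have "A ** matrix_inv A = mat 1 \<and> matrix_inv A ** A = mat 1"
    unfolding matrix_inv_def by (rule_tac someI[of _ C]) simp
  then have "matrix_inv A = C" using CA by (metis matrix_mul_assoc matrix_mul_lid matrix_mul_rid)
  then have "mat_act (matrix_inv A) z = ((A$2$2 * z - A$1$2) / d) / ((A$1$1 - A$2$1 * z) / d)"
    by (simp add: mat_act_def moebius_def C_def diff_divide_distrib)
  also have "\<dots> = (A$2$2 * z - A$1$2) / (A$1$1 - A$2$1 * z)" using d by simp
  finally show ?thesis by (metis minus_diff_eq minus_divide_divide)
qed

locale cf_execution = quad_order +
  fixes B :: "complex set" and \<epsilon> :: real and z :: complex and N :: enat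
    and a b :: "nat \<Rightarrow> complex" and M :: "nat \<Rightarrow> complex^2^2"
  assumes adm: "admissible \<Delta> B \<epsilon>" and run: "cf_run \<Delta> B \<epsilon> z N a b M"
begin

abbreviation "p k \<equiv> M k $ 1 $ 1"
abbreviation "q k \<equiv> M k $ 2 $ 1"
definition "e k = q k * z - p k"
definition "\<mu> = Max (norm ` B)"

lemma eps: "0 < \<epsilon>" "\<epsilon> < 1"
  using adm unfolding admissible_def by auto

lemma b_norm_le: "x \<in> B \<Longrightarrow> norm x \<le> \<mu>"
  using adm unfolding admissible_def \<mu>_def by auto

lemma mu_pos: "\<mu> > 0"
  using admissible_eps_mu_ge[OF adm] eps unfolding \<mu>_def by (smt (verit) mult_nonneg_nonpos divide_pos_pos)

lemma M_0: "M 0 = mat 1" and b_0: "b 0 = 1"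
  using run unfolding cf_run_def by auto

lemma step:
  assumes "enat (Suc n) \<le> N"
  shows "b (Suc n) \<in> B"
    "a (Suc n) \<in> quad_ring \<Delta>"
    "norm (b (Suc n) * mat_act (matrix_inv (M n)) z - a (Suc n)) \<le> \<epsilon> * norm (b n)"
    "M (Suc n) = M n ** S_mat (a (Suc n) / b n) (b (Suc n) / b n)"
    "reduced \<Delta> (first_col_ideal \<Delta> (M (Suc n)))"
  using run assms unfolding cf_run_def by (auto simp: dist_norm)

lemma b_nonzero:
  assumes "enat n \<le> N"
  shows "b n \<noteq> 0"
proof (cases n)
  case (Suc k)
  then show ?thesis using step(1)[of k] assms adm unfolding admissible_def by auto
qed (simp add: b_0)

lemma M_Suc:
  assumes "enat (Suc n) \<le> N"
  shows "p (Suc n) = (a (Suc n) * p n + b (Suc n) * M n $ 1 $ 2) / b n"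
    "q (Suc n) = (a (Suc n) * q n + b (Suc n) * M n $ 2 $ 2) / b n"
    "M (Suc n) $ 1 $ 2 = p n" "M (Suc n) $ 2 $ 2 = q n"
  unfolding step(4)[OF assms]
  by (simp_all add: matrix_matrix_mult_def sum_2 S_mat_def add_divide_distrib mult.commute)

text \<open>The step matrix has determinant - b (n+1) / b n, so the product telescopes from
  \<open>b 0 = 1\<close>.\<close>

lemma det_M:
  assumes "enat n \<le> N"
  shows "p n * M n $ 2 $ 2 - M n $ 1 $ 2 * q n = (-1) ^ n * b n"
  using assms
proof (induction n)
  case 0
  then show ?case by (simp add: M_0 b_0 mat_def)
next
  case (Suc n)
  then have n: "enat n \<le> N" by (meson Suc_ile_eq order_less_imp_le)
  have "p (Suc n) * q n - p n * q (Suc n) = - (b (Suc n) / b n) * (p n * M n $ 2 $ 2 - M n $ 1 $ 2 * q n)"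
    unfolding M_Suc[OF Suc.prems] by (simp add: field_simps b_nonzero[OF n])
  also have "\<dots> = (-1) ^ Suc n * b (Suc n)"
    unfolding Suc.IH[OF n] using b_nonzero[OF n] by simp
  finally show ?case unfolding M_Suc(3,4)[OF Suc.prems] .
qed

lemma det_nonzero:
  assumes "enat n \<le> N"
  shows "p n * M n $ 2 $ 2 - M n $ 1 $ 2 * q n \<noteq> 0"
  using det_M[OF assms] b_nonzero[OF assms] by simp

section \<open>Errors of the convergents\<close>

lemma e_nonzero:
  assumes "enat n < N"
  shows "e n \<noteq> 0"
proof
  assume e: "e n = 0"
  have n: "enat n \<le> N" using assms by simp
  then have not: "\<not> is_first_col_ratio (M n) z"
    using run assms unfolding cf_run_def by auto
  show False
  \<comment> \<open>The stopping rule gives no contradiction when \<open>q n\<close> vanishes; then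
    \<open>p n\<close> vanishes too, and so would the determinant.\<close>
  proof (cases "q n = 0")
    case True
    then have "p n = 0" using e unfolding e_def by simp
    then show False using True det_nonzero[OF n] by simp
  next
    case False
    then show False using e not unfolding e_def is_first_col_ratio_def by (simp add: field_simps)
  qed
qed

lemma mat_act_inv_M_Suc:
  assumes "enat (Suc n) \<le> N"
  shows "mat_act (matrix_inv (M (Suc n))) z = - e n / e (Suc n)"
  unfolding mat_act_matrix_inv[OF det_nonzero[OF assms]] M_Suc(3,4)[OF assms] e_def ..

lemma e_Suc:
  assumes "enat (Suc n) \<le> N"
  shows "e (Suc n) = e n * (a (Suc n) - b (Suc n) * mat_act (matrix_inv (M n)) z) / b n"
proof -
  have n: "enat n < N" using assms by (simp add: Suc_ile_eq)
  then have n': "enat n \<le> N" by simp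
  \<comment> \<open>The error of the second column, used instead of \<open>e (n - 1)\<close> so that
    \<open>n = 0\<close> is covered.\<close>
  define e' where "e' = M n $ 2 $ 2 * z - M n $ 1 $ 2"
  have "mat_act (matrix_inv (M n)) z = - e' / e n"
    unfolding mat_act_matrix_inv[OF det_nonzero[OF n']] e_def e'_def ..
  then have "e n * mat_act (matrix_inv (M n)) z = - e'" using e_nonzero[OF n] by simp
  then have "e n * (a (Suc n) - b (Suc n) * mat_act (matrix_inv (M n)) z) = a (Suc n) * e n + b (Suc n) * e'"
    by (simp add: algebra_simps)
  moreover have "e (Suc n) = (a (Suc n) * e n + b (Suc n) * e') / b n"
    unfolding e_def e'_def M_Suc[OF assms] using b_nonzero[OF n'] by (simp add: field_simps)
  ultimately show ?thesis by simp
qed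

lemma norm_e_Suc:
  assumes "enat (Suc n) \<le> N"
  shows "norm (e (Suc n)) \<le> \<epsilon> * norm (e n)"
proof -
  have n: "enat n \<le> N" using assms by (simp add: Suc_ile_eq less_imp_le)
  have "norm (e (Suc n)) = norm (e n) * norm (b (Suc n) * mat_act (matrix_inv (M n)) z - a (Suc n)) / norm (b n)"
    unfolding e_Suc[OF assms] by (simp add: norm_mult norm_divide norm_minus_commute)
  also have "\<dots> \<le> norm (e n) * (\<epsilon> * norm (b n)) / norm (b n)"
    using step(3)[OF assms] by (intro divide_right_mono mult_left_mono) auto
  finally show ?thesis using b_nonzero[OF n] by (simp add: mult.commute)
qed

lemma norm_e_less:
  assumes "k < n" "enat n \<le> N"
  shows "norm (e n) < norm (e k)"
  using assms
proof (induction n)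
  case (Suc n)
  have n: "enat n < N" "enat n \<le> N" using Suc.prems by (auto simp: Suc_ile_eq)
  have "norm (e (Suc n)) \<le> \<epsilon> * norm (e n)" using norm_e_Suc Suc.prems by blast
  also have "\<dots> < norm (e n)" using eps e_nonzero[OF n(1)] by simp
  finally have "norm (e (Suc n)) < norm (e n)" .
  then show ?case using Suc n by (cases "k = n") auto
qed simp

section \<open>Ideals of the columns and distinct convergents\<close>

lemma reduced_first_col:
  assumes "enat n \<le> N"
  shows "reduced \<Delta> (first_col_ideal \<Delta> (M n))"
proof (cases n)
  case 0
  have "ideal_gen \<Delta> {1, 0} = quad_ring \<Delta>"
    unfolding ideal_gen_def
  proof (rule hull_unique)
    show "quad_ring \<Delta> \<subseteq> I" if "{1, 0} \<subseteq> I" "is_submodule \<Delta> I" for I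
      using that unfolding is_submodule_def by (metis insert_subset mult.right_neutral subsetI)
  qed (use is_submodule_quad_ring one_in_quad_ring zero_in_quad_ring in auto)
  then show ?thesis using 0 reduced_quad_ring by (simp add: first_col_ideal_def M_0 mat_def)
next
  case (Suc k)
  then show ?thesis using step(5) assms by blast
qed

lemma p_q_in_quad_ring:
  assumes "enat n \<le> N"
  shows "p n \<in> quad_ring \<Delta>" "q n \<in> quad_ring \<Delta>"
proof -
  have "first_col_ideal \<Delta> (M n) \<subseteq> quad_ring \<Delta>"
    using reduced_first_col[OF assms] unfolding reduced_def integral_ideal_def by blast
  moreover have "{p n, q n} \<subseteq> first_col_ideal \<Delta> (M n)"
    unfolding first_col_ideal_def ideal_gen_def by (rule hull_subset)
  ultimately show "p n \<in> quad_ring \<Delta>" "q n \<in> quad_ring \<Delta>" by auto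
qed

text \<open>Equal convergents would make the \<open>n\<close>-th column the multiple by \<open>e n / e k\<close> of the \<open>k\<close>-th one,
  and an ideal of smaller norm would lie in the class of a reduced ideal.\<close>

lemma convergents_distinct:
  assumes "k < n" "enat n \<le> N"
  shows "p n * q k \<noteq> p k * q n"
proof
  assume eq: "p n * q k = p k * q n"
  have k: "enat k < N" "enat k \<le> N"
    using assms by (meson enat_ord_simps(2) less_le_trans less_imp_le)+
  define c where "c = e n / e k"
  have ek: "e k \<noteq> 0" using e_nonzero[OF k(1)] .
  have "q n * e k = q k * e n" "p n * e k = p k * e n"
    using eq unfolding e_def by (simp_all add: algebra_simps)
  then have pq: "q n = c * q k" "p n = c * p k"
    using ek unfolding c_def by (simp_all add: field_simps)
  have "p n \<noteq> 0 \<or> q n \<noteq> 0" using det_nonzero[OF assms(2)] by auto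
  then have c0: "c \<noteq> 0" using pq by auto
  have "p k \<noteq> 0 \<or> q k \<noteq> 0" using det_nonzero[OF k(2)] by auto
  \<comment> \<open>As \<open>z\<close> is arbitrary, membership of \<open>c\<close> in the field
    has to be read off from a nonzero coordinate of the \<open>k\<close>-th column.\<close>
  then have "c = p n / p k \<or> c = q n / q k" using pq by auto
  then have cK: "c \<in> quad_field \<Delta>"
    using quad_field_divide p_q_in_quad_ring[OF assms(2)] p_q_in_quad_ring[OF k(2)] by metis
  have c1: "norm c < 1" using norm_e_less[OF assms] ek by (simp add: c_def norm_divide)
  have "first_col_ideal \<Delta> (M n) = (*) c ` first_col_ideal \<Delta> (M k)"
    using ideal_gen_scale[OF c0, of "{p k, q k}"] unfolding first_col_ideal_def pq by simp
  then show False
    using not_reduced_scale[OF reduced_first_col[OF k(2)] reduced_first_col[OF assms(2)] cK c0 c1] by blast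
qed

lemma q_e_diff: "q n * e k - q k * e n = p n * q k - p k * q n"
  unfolding e_def by (simp add: algebra_simps)

lemma norm_q_e_diff_ge:
  assumes "k < n" "enat n \<le> N"
  shows "norm (q n * e k - q k * e n) \<ge> 1"
proof -
  have k: "enat k \<le> N" using assms by (meson enat_ord_simps(2) less_le_trans less_imp_le)
  show ?thesis
    unfolding q_e_diff
    using quad_ring_norm_ge_1 quad_ring_diff quad_ring_mult p_q_in_quad_ring[OF k]
      p_q_in_quad_ring[OF assms(2)] convergents_distinct[OF assms] by simp
qed

lemma norm_q_e_diff_le:
  assumes "enat (Suc n) \<le> N"
  shows "norm (q (Suc n) * e n - q n * e (Suc n)) \<le> \<mu>"
  using det_M[OF assms] b_norm_le[OF step(1)[OF assms]]
  unfolding q_e_diff M_Suc(3,4)[OF assms] by (simp add: norm_mult norm_power)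

text \<open>The initial convergent is 1/0, and a vanishing later denominator would repeat
  it.\<close>

lemma q_nonzero:
  assumes "enat (Suc n) \<le> N"
  shows "q (Suc n) \<noteq> 0"
  using convergents_distinct[of 0 "Suc n"] assms by (auto simp: M_0 mat_def)

text \<open>The errors up to \<open>n\<close> are nonzero even if the run stops at step
  \<open>n + 1\<close>, so the last step is covered as well.\<close>

lemma norm_q_e_lower_bounds:
  assumes "enat (Suc n) \<le> N"
  shows "(1 - \<epsilon>\<^sup>2)\<^sup>2 / (4 * (\<epsilon> * \<mu>)\<^sup>2) < norm (q (Suc n)) * norm (e n)"
    "(1 - \<epsilon>\<^sup>2)\<^sup>2 * (1 + \<epsilon> * \<mu>) / (10 * (\<epsilon> * \<mu>)^3) < norm (q (Suc n)) * norm (e n)"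
proof -
  have j: "enat (Suc j) \<le> N" if "j \<le> n" for j
    using that assms by (meson Suc_le_mono enat_ord_simps(1) order_trans)
  then have j': "enat j < N" if "j \<le> n" for j
    using that by (simp add: Suc_ile_eq)
  have "1 / (1 + \<epsilon>) \<le> norm (q (Suc n)) * norm (e n) \<or>
      (1 - \<epsilon>\<^sup>2) / (\<epsilon> * \<mu> * (1 + \<epsilon>)\<^sup>2) \<le> norm (q (Suc n)) * norm (e n)"
    using denominator_lower_bound[OF eps mu_pos, of q n e]
      norm_e_Suc[OF j] e_nonzero[OF j'] norm_q_e_diff_le[OF j] norm_q_e_diff_ge[OF _ assms]
    by (simp add: M_0 mat_def)
  then show "(1 - \<epsilon>\<^sup>2)\<^sup>2 / (4 * (\<epsilon> * \<mu>)\<^sup>2) < norm (q (Suc n)) * norm (e n)"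
    "(1 - \<epsilon>\<^sup>2)\<^sup>2 * (1 + \<epsilon> * \<mu>) / (10 * (\<epsilon> * \<mu>)^3) < norm (q (Suc n)) * norm (e n)"
    using lower_bound_constants[OF eps] admissible_eps_mu_ge[OF adm] unfolding \<mu>_def by blast+
qed

end

section \<open>The three lower bounds for a run\<close>

theorem theorem4:
  fixes \<Delta> :: int and B :: "complex set" and \<epsilon> :: real and z :: complex and N :: enat
    and a b :: "nat \<Rightarrow> complex" and M :: "nat \<Rightarrow> complex^2^2" and n :: nat
  defines "\<mu> \<equiv> Max (norm ` B)"
    and "zs \<equiv> \<lambda>k. mat_act (matrix_inv (M k)) z"
    and "p \<equiv> \<lambda>k. M k $ 1 $ 1"
    and "q \<equiv> \<lambda>k. M k $ 2 $ 1"
  assumes "\<Delta> < 0" and "\<Delta> mod 4 \<in> {0, 1}"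
    and "admissible \<Delta> B \<epsilon>"
    and "cf_run \<Delta> B \<epsilon> z N a b M"
    and "n \<ge> 1" and "enat n < N"
  shows "norm (q n * (q n * z - p n)) > (1 - \<epsilon>\<^sup>2)\<^sup>2 / (4 * \<epsilon>\<^sup>2 * \<mu>\<^sup>2 * norm (zs n)) \<and>
         norm (q n * (q n * z - p n)) >
           (1 - \<epsilon>\<^sup>2)\<^sup>2 * norm (b (n + 1)) / (10 * \<epsilon>^3 * \<mu>^3 * norm (a (n + 1))) \<and>
         norm (q n * (q n * z - p n)) >
           (1 - \<epsilon>\<^sup>2)\<^sup>2 * norm (q n) / (4 * \<epsilon>\<^sup>2 * \<mu>\<^sup>2 * norm (q (n + 1)))"
proof -
  interpret cf: cf_execution \<Delta> B \<epsilon> z N a b M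
    by unfold_locales fact+
  have [simp]: "cf.\<mu> = \<mu>" by (simp add: cf.\<mu>_def \<mu>_def)
  \<comment> \<open>The predecessor supplies the numerator in \<open>zs n\<close> = - e m / e n, and
    the step to \<open>n\<close> puts \<open>b n\<close> in \<open>B\<close>.\<close>
  obtain m where m: "n = Suc m" using \<open>n \<ge> 1\<close> by (cases n) auto
  have n: "enat (Suc m) \<le> N" using \<open>enat n < N\<close> unfolding m by (rule less_imp_le)
  have n1: "enat (Suc n) \<le> N" using \<open>enat n < N\<close> by (simp only: Suc_ile_eq)
  from n have mN: "enat m < N" by (simp only: Suc_ile_eq)
  define h where "h = \<epsilon> * \<mu>"
  define P where "P = norm (q n) * norm (cf.e m)"
  define L where "L = norm (q n * (q n * z - p n))"
  have h: "h > 0" using cf.eps cf.mu_pos by (simp add: h_def)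
  have e: "cf.e n \<noteq> 0" "cf.e m \<noteq> 0" using cf.e_nonzero mN \<open>enat n < N\<close> by auto
  have qn: "q n \<noteq> 0" "q (Suc n) \<noteq> 0" using cf.q_nonzero n n1 by (auto simp: q_def m)
  have L: "L = norm (q n) * norm (cf.e n)" by (simp add: L_def cf.e_def p_def q_def norm_mult)
  have L0: "L > 0" using qn e by (simp add: L)
  have zs: "norm (zs n) = norm (cf.e m) / norm (cf.e n)"
    unfolding zs_def m cf.mat_act_inv_M_Suc[OF n] by (simp add: norm_divide)
  have zs0: "norm (zs n) > 0" using e by (simp add: zs)
  have LP: "L * norm (zs n) = P" using e by (simp add: L P_def zs)
  have "(1 - \<epsilon>\<^sup>2)\<^sup>2 / (4 * h\<^sup>2) < L * norm (zs n)"
    using cf.norm_q_e_lower_bounds(1)[OF n] unfolding LP by (simp add: P_def q_def m h_def)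
  then have i: "(1 - \<epsilon>\<^sup>2)\<^sup>2 / (4 * h\<^sup>2) / norm (zs n) < L"
    using zs0 by (simp only: pos_divide_less_eq)
  \<comment> \<open>(iii) is the same bound one step later, multiplied by |q n| / |q (n+1)|.\<close>
  have "(1 - \<epsilon>\<^sup>2)\<^sup>2 / (4 * h\<^sup>2) < norm (q (Suc n)) * norm (cf.e n)"
    using cf.norm_q_e_lower_bounds(1)[OF n1] by (simp add: q_def h_def)
  then have "(1 - \<epsilon>\<^sup>2)\<^sup>2 / (4 * h\<^sup>2) * norm (q n) < norm (q (Suc n)) * norm (cf.e n) * norm (q n)"
    using qn by (intro mult_strict_right_mono) auto
  also have "\<dots> = L * norm (q (Suc n))" by (simp add: L)
  finally have iii: "(1 - \<epsilon>\<^sup>2)\<^sup>2 / (4 * h\<^sup>2) * norm (q n) / norm (q (Suc n)) < L"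
    using qn by (metis pos_divide_less_eq zero_less_norm_iff)
  have ii: "(1 - \<epsilon>\<^sup>2)\<^sup>2 * norm (b (Suc n)) / (10 * h^3 * norm (a (Suc n))) < L"
  \<comment> \<open>For a vanishing \<open>a (Suc n)\<close> the left side is a quotient by 0, hence
    0.\<close>
  proof (cases "a (Suc n) = 0")
    case True
    then show ?thesis using L0 by simp
  next
    case False
    have a1: "norm (a (Suc n)) \<ge> 1"
      using cf.quad_ring_norm_ge_1[OF cf.step(2)[OF n1] False] .
    define K where "K = (1 - \<epsilon>\<^sup>2)\<^sup>2 / (10 * h^3)"
    have K: "K * (1 + h) < P"
      using cf.norm_q_e_lower_bounds(2)[OF n] by (simp add: K_def P_def q_def m h_def mult.commute)
    have K0: "K \<ge> 0" using h by (simp add: K_def)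
    \<comment> \<open>\<open>b (Suc n) * zs n\<close> lies within \<epsilon> |b n| \<le> h of
      \<open>a (Suc n)\<close>, and |a (Suc n)| \<ge> 1 absorbs \<open>h\<close> into the factor 1 +
      h.\<close>
    have "norm (b (Suc n)) * norm (zs n) \<le> norm (a (Suc n)) + \<epsilon> * norm (b n)"
      using cf.step(3)[OF n1] norm_triangle_sub[of "b (Suc n) * zs n" "a (Suc n)"]
      unfolding zs_def by (simp add: norm_mult)
    also have "\<epsilon> * norm (b n) \<le> h"
      using cf.b_norm_le[OF cf.step(1)[OF n]] cf.eps by (simp add: m h_def)
    also have "norm (a (Suc n)) + h \<le> norm (a (Suc n)) * (1 + h)"
      using a1 h by (simp add: distrib_left)
    finally have "K * (norm (b (Suc n)) * norm (zs n)) \<le> K * (norm (a (Suc n)) * (1 + h))"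
      using K0 by (intro mult_left_mono) auto
    also have "\<dots> = norm (a (Suc n)) * (K * (1 + h))" by simp
    also have "\<dots> < norm (a (Suc n)) * P" using K a1 by (intro mult_strict_left_mono) auto
    also have "\<dots> = L * norm (a (Suc n)) * norm (zs n)" by (simp add: LP[symmetric])
    finally have "K * norm (b (Suc n)) < L * norm (a (Suc n))"
      using zs0 by (simp add: mult.assoc[symmetric])
    then have "K * norm (b (Suc n)) / norm (a (Suc n)) < L"
      using False by (metis pos_divide_less_eq zero_less_norm_iff)
    then show ?thesis by (simp add: K_def)
  qed
  show ?thesis
    using i ii iii unfolding L_def h_def by (simp add: power_mult_distrib mult.assoc)
qed

end
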